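(* Let $V$ be a finite-dimensional vector space over a field $K$ of characteristic zero, let $\mathfrak{n}=(V,\{\,,\})$ be a Lie algebra, let $R$ be a Rota–Baxter operator of weight $1$ on $\mathfrak{n}$, and let $x\cdot y=\{R(x),y\}$ be the PA-structure on $(\mathfrak{g},\mathfrak{n})$ defined by $R$, where $\mathfrak{g}=(V,[\,,])$ has Lie bracket $[x,y]=\{R(x),y\}-\{R(y),x\}+\{x,y\}$. Then the following holds. (1) If $\mathfrak{g}$ and $\mathfrak{n}$ are not isomorphic, then both $R$ and $R+\mathrm{id}$ have a non-trivial kernel. (2) If either $\mathfrak{g}$ or $\mathfrak{n}$ is not solvable, then at least one of the operators $R$ and $R+\mathrm{id}$ has a non-trivial kernel.
   Context: A Rota–Baxter operator (RB-operator) of weight $1$ on a Lie algebra $\mathfrak{n}=(V,\{\,,\})$ is a linear map $R\colon V\to V$ with $\{R(x),R(y)\}=R(\{R(x),y\}+\{x,R(y)\}+\{x,y\})$ for all $x,y\in V$. A post-Lie algebra structure (PA-structure) on a pair of Lie algebras $\mathfrak{g}=(V,[\,,])$, $\mathfrak{n}=(V,\{\,,\})$ on the same vector space is a bilinear product $x\cdot y$ on $V$ satisfying, for all $x,y,z\in V$: (i) $x\cdot y-y\cdot x=[x,y]-\{x,y\}$; (ii) $[x,y]\cdot z=x\cdot(y\cdot z)-y\cdot(x\cdot z)$; (iii) $x\cdot\{y,z\}=\{x\cdot y,z\}+\{y,x\cdot z\}$. If $R$ is an RB-operator of weight $1$ on $\mathfrak{n}$, then $[x,y]=\{R(x),y\}-\{R(y),x\}+\{x,y\}$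 is a Lie bracket on $V$ and $x\cdot y=\{R(x),y\}$ is a PA-structure on $(\mathfrak{g},\mathfrak{n})$. *)

theory Defs
  imports Complex_Main
begin

locale lie_algebra = vector_space scale
  for scale :: "'k::field \<Rightarrow> 'v::ab_group_add \<Rightarrow> 'v" +
  fixes bracket :: "'v \<Rightarrow> 'v \<Rightarrow> 'v"
  assumes linear_left: "\<And>y. Vector_Spaces.linear scale scale (\<lambda>x. bracket x y)"
    and linear_right: "\<And>x. Vector_Spaces.linear scale scale (bracket x)"
    and alternating: "\<And>x. bracket x x = 0"
    and jacobi: "\<And>x y z. bracket x (bracket y z) + bracket y (bracket z x)
                        + bracket z (bracket x y) = 0"

text \<open>
  The underlying vector space of a Lie algebra is the whole type, so that several brackets
  can live on one space. The derived series is a series of subspaces: each term is the span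
  of the brackets of elements of the previous one, not just the set of these brackets.
\<close>

definition lie_isomorphic ::
  "('k::field \<Rightarrow> 'v::ab_group_add \<Rightarrow> 'v) \<Rightarrow> ('v \<Rightarrow> 'v \<Rightarrow> 'v) \<Rightarrow>
   ('k \<Rightarrow> 'w::ab_group_add \<Rightarrow> 'w) \<Rightarrow> ('w \<Rightarrow> 'w \<Rightarrow> 'w) \<Rightarrow> bool"
  where "lie_isomorphic s1 br1 s2 br2 \<longleftrightarrow>
    (\<exists>f. Vector_Spaces.linear s1 s2 f \<and> bij f \<and> (\<forall>x y. f (br1 x y) = br2 (f x) (f y)))"

primrec derived_series ::
  "('k::field \<Rightarrow> 'v::ab_group_add \<Rightarrow> 'v) \<Rightarrow> ('v \<Rightarrow> 'v \<Rightarrow> 'v) \<Rightarrow> nat \<Rightarrow> 'v set"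
  where
    "derived_series scale br 0 = UNIV"
  | "derived_series scale br (Suc n) = module.span scale
       {br x y | x y. x \<in> derived_series scale br n \<and> y \<in> derived_series scale br n}"

definition lie_solvable ::
  "('k::field \<Rightarrow> 'v::ab_group_add \<Rightarrow> 'v) \<Rightarrow> ('v \<Rightarrow> 'v \<Rightarrow> 'v) \<Rightarrow> bool"
  where "lie_solvable scale br \<longleftrightarrow> (\<exists>n. derived_series scale br n = {0})"

definition kernel :: "('v \<Rightarrow> 'w::zero) \<Rightarrow> 'v set"
  where "kernel f = {x. f x = 0}"

text \<open>Rota--Baxter operators are always of weight 1 here.\<close>

locale rota_baxter = n: lie_algebra scale nbr
  for scale :: "'k::field \<Rightarrow> 'v::ab_group_add \<Rightarrow> 'v"
    and nbr :: "'v \<Rightarrow> 'v \<Rightarrow> 'v" +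
  fixes R :: "'v \<Rightarrow> 'v"
  assumes linear_R: "Vector_Spaces.linear scale scale R"
    and rota_baxter: "\<And>x y. nbr (R x) (R y) = R (nbr (R x) y + nbr x (R y) + nbr x y)"

locale pa_structure = g: lie_algebra scale gbr + n: lie_algebra scale nbr
  for scale :: "'k::field \<Rightarrow> 'v::ab_group_add \<Rightarrow> 'v"
    and gbr :: "'v \<Rightarrow> 'v \<Rightarrow> 'v" and nbr :: "'v \<Rightarrow> 'v \<Rightarrow> 'v" +
  fixes dot :: "'v \<Rightarrow> 'v \<Rightarrow> 'v"
  assumes dot_linear_left: "\<And>y. Vector_Spaces.linear scale scale (\<lambda>x. dot x y)"
    and dot_linear_right: "\<And>x. Vector_Spaces.linear scale scale (dot x)"
    and dot_commutator: "\<And>x y. dot x y - dot y x = gbr x y - nbr x y"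
    and dot_gbr: "\<And>x y z. dot (gbr x y) z = dot x (dot y z) - dot y (dot x z)"
    and dot_derivation: "\<And>x y z. dot x (nbr y z) = nbr (dot x y) z + nbr y (dot x z)"

context rota_baxter
begin

definition induced_bracket :: "'v \<Rightarrow> 'v \<Rightarrow> 'v"
  where "induced_bracket x y = nbr (R x) y - nbr (R y) x + nbr x y"

definition induced_product :: "'v \<Rightarrow> 'v \<Rightarrow> 'v"
  where "induced_product x y = nbr (R x) y"

lemma nbr_simps:
  "nbr (x + y) z = nbr x z + nbr y z" "nbr z (x + y) = nbr z x + nbr z y"
  "nbr (x - y) z = nbr x z - nbr y z" "nbr z (x - y) = nbr z x - nbr z y"
  "nbr (- x) z = - nbr x z" "nbr z (- x) = - nbr z x"
  "nbr (scale c x) z = scale c (nbr x z)" "nbr z (scale c x) = scale c (nbr z x)"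
  "nbr x x = 0"
proof -
  interpret a: Vector_Spaces.linear scale scale "\<lambda>x. nbr x y" for y by (rule n.linear_left)
  interpret b: Vector_Spaces.linear scale scale "nbr y" for y by (rule n.linear_right)
  show "nbr (x + y) z = nbr x z + nbr y z" "nbr z (x + y) = nbr z x + nbr z y"
    "nbr (x - y) z = nbr x z - nbr y z" "nbr z (x - y) = nbr z x - nbr z y"
    "nbr (- x) z = - nbr x z" "nbr z (- x) = - nbr z x"
    "nbr (scale c x) z = scale c (nbr x z)" "nbr z (scale c x) = scale c (nbr z x)"
    by (simp_all add: a.add b.add a.diff b.diff a.neg b.neg a.scale b.scale)
qed (rule n.alternating)

lemma nbr_anticomm: "nbr x y = - nbr y x"
proof -
  have "nbr (x + y) (x + y) = 0" by (rule n.alternating)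
  then have "nbr x y + nbr y x = 0"
    by (simp only: nbr_simps(1,2)) (simp add: nbr_simps(9) add.commute)
  then show ?thesis by (simp add: eq_neg_iff_add_eq_0)
qed

lemma nbr_derivation: "nbr x (nbr y z) = nbr (nbr x y) z + nbr y (nbr x z)"
  using n.jacobi[of x y z] nbr_anticomm[of z "nbr x y"] nbr_anticomm[of z x]
  by (simp add: nbr_simps algebra_simps)

lemma R_simps: "R (x + y) = R x + R y" "R (x - y) = R x - R y" "R (scale c x) = scale c (R x)"
proof -
  interpret Vector_Spaces.linear scale scale R by (rule linear_R)
  show "R (x + y) = R x + R y" "R (x - y) = R x - R y" "R (scale c x) = scale c (R x)"
    by (rule add diff scale)+
qed

lemma R_induced_bracket: "R (induced_bracket x y) = nbr (R x) (R y)"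
  unfolding rota_baxter induced_bracket_def using nbr_anticomm[of x "R y"] by simp

lemma lin: "Vector_Spaces.linear scale scale f"
  if "\<And>x y. f (x + y) = f x + f y" "\<And>c x. f (scale c x) = scale c (f x)"
  using that n.vector_space_axioms by (simp add: Vector_Spaces.linear_iff)

lemma lie_algebra_induced: "lie_algebra scale induced_bracket"
proof unfold_locales
  fix x y z
  let ?b = induced_bracket
  have e: "?b x (?b y z) = nbr (R x) (nbr (R y) z) + nbr (R x) (nbr y (R z)) + nbr (R x) (nbr y z)
     + nbr x (nbr (R y) (R z)) + nbr x (nbr (R y) z) + nbr x (nbr y (R z)) + nbr x (nbr y z)" for x y z
    unfolding induced_bracket_def[of x] R_induced_bracket
    using nbr_anticomm[of "R z" y] nbr_anticomm[of "nbr (R y) (R z)" x]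
    by (simp add: induced_bracket_def nbr_simps)
  have eq: "?b x (?b y z) + ?b y (?b z x) + ?b z (?b x y) =
     (nbr (R x) (nbr (R y) z) + nbr (R y) (nbr z (R x)) + nbr z (nbr (R x) (R y))) +
     (nbr (R x) (nbr y (R z)) + nbr y (nbr (R z) (R x)) + nbr (R z) (nbr (R x) y)) +
     (nbr x (nbr (R y) (R z)) + nbr (R y) (nbr (R z) x) + nbr (R z) (nbr x (R y))) +
     (nbr (R x) (nbr y z) + nbr y (nbr z (R x)) + nbr z (nbr (R x) y)) +
     (nbr x (nbr (R y) z) + nbr (R y) (nbr z x) + nbr z (nbr x (R y))) +
     (nbr x (nbr y (R z)) + nbr y (nbr (R z) x) + nbr (R z) (nbr x y)) +
     (nbr x (nbr y z) + nbr y (nbr z x) + nbr z (nbr x y))"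
    unfolding e by (simp add: algebra_simps)
  show "?b x (?b y z) + ?b y (?b z x) + ?b z (?b x y) = 0"
    unfolding eq n.jacobi by simp
qed (auto intro!: lin simp: induced_bracket_def nbr_simps R_simps algebra_simps
       n.scale_right_distrib n.scale_right_diff_distrib)

lemma pa_structure_induced: "pa_structure scale induced_bracket nbr induced_product"
proof -
  interpret g: lie_algebra scale induced_bracket by (rule lie_algebra_induced)
  show ?thesis
  proof unfold_locales
    fix x y z
    show "induced_product (induced_bracket x y) z =
      induced_product x (induced_product y z) - induced_product y (induced_product x z)"
      unfolding induced_product_def R_induced_bracket using nbr_derivation[of "R x" "R y" z]
      by simp
    show "induced_product x (nbr y z) = nbr (induced_product x y) z + nbr y (induced_product x z)"
      unfolding induced_product_def by (rule nbr_derivation)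
  qed (auto intro!: lin simp: induced_bracket_def induced_product_def nbr_simps R_simps)
qed

lemma pa_structure_of_rota_baxter:
  assumes "\<And>x y. gbr x y = nbr (R x) y - nbr (R y) x + nbr x y"
    and "\<And>x y. dot x y = nbr (R x) y"
  shows "pa_structure scale gbr nbr dot"
proof -
  have "gbr = induced_bracket" "dot = induced_product"
    by (intro ext; simp add: assms induced_bracket_def induced_product_def)+
  then show ?thesis using pa_structure_induced by simp
qed

end

end

theory Submission
  imports
    "HOL-Algebra.Algebraic_Closure_Type"
    "HOL-Library.Function_Algebras"
    Defs
begin

text \<open>
  Both \<open>R\<close> and \<open>R + id\<close> are homomorphisms from \<open>g\<close> to \<open>n\<close>. In finite dimension, an injective one
  is an isomorphism, which gives the first part. If both are injective, then
  \<open>A = (R + id) R\<^sup>-\<^sup>1 = id + R\<^sup>-\<^sup>1\<close> is an automorphism of \<open>n\<close>, and \<open>A x = x\<close> forces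
  \<open>R\<^sup>-\<^sup>1 x = 0\<close>. So the second part follows from the theorem that a finite-dimensional Lie algebra with
  an automorphism that fixes no non-zero vector is solvable
  (\<open>fixed_point_free_automorphism_imp_solvable\<close>); the algebra \<open>g\<close> is then solvable too,
  being isomorphic to \<open>n\<close>.

  For that theorem, it suffices to show that a perfect subalgebra \<open>N\<close> that is invariant under \<open>A\<close>
  is trivial, and this may be done over the algebraic closure \<open>L\<close> of the field. There,
  \<open>N\<close> is the direct sum of the generalized eigenspaces of \<open>A\<close>, and the bracket of the spaces for
  \<open>l\<close> and \<open>m\<close> lies in the one for \<open>l m\<close>. This is a grading by the multiplicative group of \<open>L\<close>
  whose component at 1 is trivial.

  The finite subgroups of this group are cyclic, and this allows its elements to be
  arranged on a circle, compatibly with multiplication. Cutting the circle at 1 gives a linear order of the eigenvalues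
  in which the factors of a product are both smaller or both larger than the product
  (\<open>cyclic_rank\<close>). With such an order, Kreknin's argument for gradings by cyclic groups applies
  (\<open>graded_perfect_trivial\<close>): the components can be discarded in increasing order, and those that
  remain still generate \<open>N\<close>. In the end none remains, so \<open>N\<close> is trivial.
\<close>

section \<open>The multiplicative group of an algebraically closed field\<close>

definition torsion_free_subgroup :: "'a::field set \<Rightarrow> bool" where
  "torsion_free_subgroup K \<longleftrightarrow> 1 \<in> K \<and> 0 \<notin> K \<and> (\<forall>x\<in>K. \<forall>y\<in>K. x * y \<in> K) \<and>
     (\<forall>x\<in>K. inverse x \<in> K) \<and> (\<forall>x\<in>K. \<forall>n>0. x ^ n = 1 \<longrightarrow> x = 1)"

lemma torsion_free_subgroupD:
  assumes "torsion_free_subgroup K"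
  shows "1 \<in> K" "0 \<notin> K" "x \<in> K \<Longrightarrow> y \<in> K \<Longrightarrow> x * y \<in> K" "x \<in> K \<Longrightarrow> inverse x \<in> K"
    "x \<in> K \<Longrightarrow> x \<noteq> 0" "x \<in> K \<Longrightarrow> y \<in> K \<Longrightarrow> x / y \<in> K"
    "x \<in> K \<Longrightarrow> n > 0 \<Longrightarrow> x ^ n = 1 \<Longrightarrow> x = 1"
proof -
  note * = assms[unfolded torsion_free_subgroup_def]
  show "1 \<in> K" "0 \<notin> K" using * by (iprover)+
  then show "x \<noteq> 0" if "x \<in> K" using that by metis
  show mult: "x * y \<in> K" if "x \<in> K" "y \<in> K" for x y using * that by metis
  show inv: "inverse x \<in> K" if "x \<in> K" for x using * that by metis
  show "x / y \<in> K" if "x \<in> K" "y \<in> K"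
    using mult[OF that(1) inv[OF that(2)]] by (simp add: divide_inverse)
  show "x = 1" if "x \<in> K" "n > 0" "x ^ n = 1" using * that by metis
qed

lemma torsion_free_subgroup_power:
  assumes "torsion_free_subgroup K" "x \<in> K"
  shows "x ^ n \<in> K" "x powi m \<in> K"
proof -
  show p: "x ^ n \<in> K" for n
    by (induction n) (use torsion_free_subgroupD(1,3)[OF assms(1)] assms(2) in auto)
  show "x powi m \<in> K"
    using p torsion_free_subgroupD(4)[OF assms(1) p]
    by (auto simp: power_int_def power_inverse)
qed

text \<open>
  The exponents \<open>j\<close> with \<open>x\<^sup>j \<in> H\<close> form a subgroup of the integers, so they are the
  multiples of one of them.
\<close>

lemma power_exponents_principal:
  fixes x :: "'a::field"
  assumes "x \<noteq> 0" "1 \<in> H" and mult: "\<And>a b. a \<in> H \<Longrightarrow> b \<in> H \<Longrightarrow> a * b \<in> H"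
    and inv: "\<And>a. a \<in> H \<Longrightarrow> inverse a \<in> H"
  obtains i :: nat where "x ^ i \<in> H" "\<And>j::int. x powi j \<in> H \<Longrightarrow> int i dvd j"
proof (cases "\<exists>i>0. x ^ i \<in> H")
  case False
  show thesis
  proof (rule that[of 0])
    fix j :: int assume j: "x powi j \<in> H"
    have "x ^ nat \<bar>j\<bar> \<in> H"
      using j inv[OF j] by (cases "j \<ge> 0") (auto simp: power_int_def power_inverse)
    with False have "nat \<bar>j\<bar> = 0" by (meson gr0I)
    then show "int 0 dvd j" by simp
  qed (use assms in simp)
next
  case True
  define i where "i = (LEAST i. i > 0 \<and> x ^ i \<in> H)"
  have i: "i > 0" "x ^ i \<in> H" using LeastI_ex[OF True] by (auto simp: i_def)
  have min: "i \<le> k" if "k > 0" "x ^ k \<in> H" for k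
    unfolding i_def by (rule Least_le) (use that in auto)
  show thesis
  proof (rule that[OF i(2)])
    fix j :: int assume j: "x powi j \<in> H"
    define q where "q = j div int i"
    have pw: "(x ^ i) ^ n \<in> H" for n by (induction n) (use assms i in auto)
    have "(x ^ i) powi (- q) \<in> H"
      using pw inv[OF pw] by (auto simp: power_int_def power_inverse)
    then have "x powi j * (x ^ i) powi (- q) \<in> H" using j mult by blast
    also have "x powi j * (x ^ i) powi (- q) = x powi (j - int i * q)"
      using assms(1) by (simp add: power_int_diff power_int_mult power_int_minus divide_inverse)
    also have "j - int i * q = j mod int i" by (simp add: q_def minus_mult_div_eq_mod)
    also have "x powi (j mod int i) = x ^ nat (j mod int i)" using i by (simp add: power_int_def)
    finally have "x ^ nat (j mod int i) \<in> H" .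
    then have "\<not> nat (j mod int i) > 0"
      using min[of "nat (j mod int i)"] i(1) pos_mod_bound[of "int i" j] by linarith
    then have "j mod int i = 0" using i(1) pos_mod_sign[of "int i" j] by linarith
    then show "int i dvd j" by (simp add: dvd_eq_mod_eq_0)
  qed
qed

text \<open>
  The roots of unity form a divisible group, because roots can be extracted; this is why they
  split off as a direct factor. Take a maximal torsion-free subgroup \<open>K\<close> and let \<open>H\<close> be the
  product of \<open>K\<close> with the roots of unity. If \<open>x\<^sup>i\<close> is the smallest power of \<open>x\<close> in \<open>H\<close>, then
  dividing \<open>x\<close> by a suitable root of unity moves this power into \<open>K\<close>, and the quotient
  can be adjoined to \<open>K\<close> without creating torsion. By maximality it lies in \<open>K\<close>.
\<close>

lemma torsion_complement:
  obtains K :: "'a::alg_closed_field set" where "torsion_free_subgroup K"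
    "\<And>x. x \<noteq> 0 \<Longrightarrow> \<exists>k\<in>K. \<exists>z n. n > 0 \<and> z ^ n = 1 \<and> x = k * z"
proof -
  define F where "F = {K::'a set. torsion_free_subgroup K}"
  have "\<exists>M\<in>F. \<forall>N\<in>F. M \<subseteq> N \<longrightarrow> N = M"
  proof (rule subset_Zorn_nonempty)
    have "torsion_free_subgroup {1::'a}" by (simp add: torsion_free_subgroup_def)
    then show "F \<noteq> {}" unfolding F_def by blast
  next
    fix C assume C: "C \<noteq> {}" "subset.chain F C"
    have two: "\<exists>K\<in>C. x \<in> K \<and> y \<in> K" if "x \<in> \<Union>C" "y \<in> \<Union>C" for x y
      using that C(2) unfolding subset.chain_def by blast
    have sub: "torsion_free_subgroup K" if "K \<in> C" for K
      using that C(2) unfolding subset.chain_def F_def by blast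
    have "torsion_free_subgroup (\<Union>C)"
      unfolding torsion_free_subgroup_def
    proof (intro conjI ballI allI impI)
      show "1 \<in> \<Union>C" using C(1) sub torsion_free_subgroupD(1) by blast
      show "0 \<notin> \<Union>C" using sub torsion_free_subgroupD(2) by blast
      show "x * y \<in> \<Union>C" if "x \<in> \<Union>C" "y \<in> \<Union>C" for x y
        using two[OF that] sub torsion_free_subgroupD(3) by blast
      show "inverse x \<in> \<Union>C" if "x \<in> \<Union>C" for x
        using that sub torsion_free_subgroupD(4) by blast
      show "x = 1" if "x \<in> \<Union>C" "n > 0" "x ^ n = 1" for x n
        using that sub torsion_free_subgroupD(7) by blast
    qed
    then show "\<Union>C \<in> F" by (simp add: F_def)
  qed
  then obtain K :: "'a set" where K: "torsion_free_subgroup K"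
    and max: "\<And>N. torsion_free_subgroup N \<Longrightarrow> K \<subseteq> N \<Longrightarrow> N = K" unfolding F_def by blast
  note D = torsion_free_subgroupD[OF K]
  define H where "H = {k * z | k z. k \<in> K \<and> (\<exists>n>0. z ^ n = 1)}"
  have HI: "k * z \<in> H" if "k \<in> K" "n > 0" "z ^ n = 1" for k z n
    using that by (auto simp: H_def)
  have Hmult: "a * b \<in> H" if ab: "a \<in> H" "b \<in> H" for a b
  proof -
    from ab obtain k z n l y m where "a = k * z" "k \<in> K" "n > 0" "z ^ n = 1"
      "b = l * y" "l \<in> K" "m > 0" "y ^ m = 1" unfolding H_def by blast
    moreover from this have "z ^ (n * m) = 1" "y ^ (n * m) = 1"
      by (metis power_mult power_one, metis power_mult power_one mult.commute)
    ultimately have "(k * l) * (z * y) \<in> H"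
      by (intro HI[of _ "n * m"]) (auto simp: D power_mult_distrib)
    then show ?thesis using \<open>a = _\<close> \<open>b = _\<close> by (simp add: mult_ac)
  qed
  have Hinv: "inverse a \<in> H" if a: "a \<in> H" for a
  proof -
    from a obtain k z n where "a = k * z" "k \<in> K" "n > 0" "z ^ n = 1" unfolding H_def by blast
    then have "inverse k * inverse z \<in> H" by (intro HI[of _ n]) (auto simp: D power_inverse)
    then show ?thesis using \<open>a = _\<close> by (simp add: mult_ac)
  qed
  have H1: "1 \<in> H" using HI[of 1 1 1] D by simp
  have KH: "K \<subseteq> H" using HI[of _ 1 1] by auto
  have tors: "z \<in> H" if "n > 0" "z ^ n = 1" for z n using HI[of 1 n z] D that by simp
  have "x \<in> H" if x0: "x \<noteq> 0" for x
  proof -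
    obtain i :: nat where i: "x ^ i \<in> H" "\<And>j::int. x powi j \<in> H \<Longrightarrow> int i dvd j"
      using power_exponents_principal[OF x0 H1 Hmult Hinv] by blast
    obtain y m where y: "m > 0" "y ^ m = 1" "(x / y) ^ i \<in> K"
    proof (cases "i = 0")
      case True
      then show thesis using that[of 1 1] D by simp
    next
      case False
      obtain k z n where kz: "x ^ i = k * z" "k \<in> K" "n > 0" "z ^ n = 1"
        using i(1) unfolding H_def by blast
      obtain y where y: "y ^ i = z" using nth_root_exists[of i z] False by auto
      show thesis
      proof (rule that[of "i * n" y])
        have "z \<noteq> 0" using kz by (auto simp: power_0_left)
        then show "(x / y) ^ i \<in> K" using kz y by (simp add: power_divide)
      qed (use False kz y in \<open>auto simp: power_mult\<close>)
    qed
    have y0: "y \<noteq> 0" using y by (auto simp: power_0_left)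
    define u where "u = x / y"
    have u0: "u \<noteq> 0" using x0 y0 by (simp add: u_def)
    \<comment> \<open>The group generated by \<open>K\<close> and \<open>u\<close>; a torsion element of it has its power of \<open>u\<close> in \<open>H\<close>,
      hence in \<open>K\<close>, so it lies in \<open>K\<close> itself.\<close>
    define K' where "K' = {k * u powi j | k j. k \<in> K}"
    have uK: "u powi j \<in> K" if "u powi j \<in> H" for j
    proof -
      have "(y powi j) ^ m = (y ^ m) powi j"
        by (simp add: power_int_power power_int_power' mult.commute)
      then have "y powi j \<in> H" using y by (intro tors[of m]) auto
      then have "u powi j * y powi j \<in> H" using that Hmult by blast
      then have "x powi j \<in> H" using y0 by (simp add: u_def power_int_divide_distrib)
      then obtain q where "j = int i * q" using i(2) by (auto elim: dvdE)
      then have "u powi j = (u ^ i) powi q" by (simp add: power_int_mult)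
      then show ?thesis using torsion_free_subgroup_power(2)[OF K y(3)] by (simp add: u_def)
    qed
    have "torsion_free_subgroup K'"
      unfolding torsion_free_subgroup_def
    proof (intro conjI ballI allI impI)
      show "1 \<in> K'" unfolding K'_def using D(1) by (force intro: exI[of _ "0::int"])
      show "0 \<notin> K'" unfolding K'_def using D(5) u0 by auto
    next
      fix a b assume "a \<in> K'" "b \<in> K'"
      then obtain k j l q where *: "a = k * u powi j" "k \<in> K" "b = l * u powi q" "l \<in> K"
        unfolding K'_def by blast
      then have "a * b = (k * l) * u powi (j + q)" using u0 by (simp add: power_int_add mult_ac)
      then show "a * b \<in> K'" unfolding K'_def using D(3)[OF *(2,4)] by blast
    next
      fix a assume "a \<in> K'"
      then obtain k j where *: "a = k * u powi j" "k \<in> K" unfolding K'_def by blast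
      then have "inverse a = inverse k * u powi (- j)" by (simp add: power_int_minus mult_ac)
      then show "inverse a \<in> K'" unfolding K'_def using D(4)[OF *(2)] by blast
    next
      fix a n assume "a \<in> K'" and n: "n > 0" "a ^ n = 1"
      then obtain k j where *: "a = k * u powi j" "k \<in> K" unfolding K'_def by blast
      have "u powi j = inverse k * a" using * D(5)[OF *(2)] by simp
      also have "\<dots> \<in> H" using KH D(4)[OF *(2)] tors[OF n] Hmult by blast
      finally have "a \<in> K" using uK * D(3) by blast
      then show "a = 1" using D(7) n by blast
    qed
    moreover have "K \<subseteq> K'" unfolding K'_def by (force intro: exI[of _ "0::int"])
    ultimately have "K' = K" by (rule max)
    moreover have "u \<in> K'" unfolding K'_def using D(1) by (auto intro!: exI[of _ "1::'a"] exI[of _ "1::int"])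
    ultimately have "u * y \<in> H" using HI y by blast
    then show ?thesis using y0 by (simp add: u_def)
  qed
  then show thesis using that[OF K] unfolding H_def by blast
qed

text \<open>
  Torsion-free abelian groups can be totally ordered. The positive cone is a maximal
  multiplicatively closed set \<open>P\<close> that avoids 1: if neither \<open>x\<close> nor its inverse could be in \<open>P\<close>,
  there would be relations \<open>m x\<^sup>i = 1\<close> and \<open>l x\<^sup>-\<^sup>j = 1\<close> with \<open>m\<close>, \<open>l\<close> in \<open>P\<close>, and then
  \<open>m\<^sup>j l\<^sup>i = 1\<close> would be in \<open>P\<close>.
\<close>

lemma torsion_free_orderable:
  fixes K :: "'a::field set"
  assumes K: "torsion_free_subgroup K"
  obtains P where "P \<subseteq> K" "1 \<notin> P" "\<And>x y. x \<in> P \<Longrightarrow> y \<in> P \<Longrightarrow> x * y \<in> P"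
    "\<And>x. x \<in> K \<Longrightarrow> x \<noteq> 1 \<Longrightarrow> x \<in> P \<or> inverse x \<in> P"
proof -
  note D = torsion_free_subgroupD[OF K]
  define F where "F = {P. P \<subseteq> K \<and> 1 \<notin> P \<and> (\<forall>x\<in>P. \<forall>y\<in>P. x * y \<in> P)}"
  have "\<exists>M\<in>F. \<forall>N\<in>F. M \<subseteq> N \<longrightarrow> N = M"
  proof (rule subset_Zorn_nonempty)
    show "F \<noteq> {}" unfolding F_def by blast
  next
    fix C assume C: "C \<noteq> {}" "subset.chain F C"
    have two: "\<exists>P\<in>C. x \<in> P \<and> y \<in> P" if "x \<in> \<Union>C" "y \<in> \<Union>C" for x y
      using that C(2) unfolding subset.chain_def by blast
    have CA: "C \<subseteq> F" using C(2) unfolding subset.chain_def by blast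
    have "x * y \<in> \<Union>C" if "x \<in> \<Union>C" "y \<in> \<Union>C" for x y
      using two[OF that] CA unfolding F_def by blast
    then show "\<Union>C \<in> F" using CA unfolding F_def by blast
  qed
  then obtain P :: "'a set" where "P \<in> F" and max: "\<And>N. N \<in> F \<Longrightarrow> P \<subseteq> N \<Longrightarrow> N = P"
    by blast
  then have P: "P \<subseteq> K" "1 \<notin> P" "\<And>x y. x \<in> P \<Longrightarrow> y \<in> P \<Longrightarrow> x * y \<in> P"
    by (auto simp: F_def)
  have step: "\<exists>m\<in>P. \<exists>i>0. m * y ^ i = 1" if y: "y \<in> K" "y \<noteq> 1" "y \<notin> P" for y
  proof -
    define Q where "Q = {m * y ^ i | m i. m \<in> insert 1 P \<and> (m \<in> P \<or> i > 0)}"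
    have QI: "m * y ^ i \<in> Q" if "m \<in> insert 1 P" "m \<in> P \<or> i > 0" for m i
      using that unfolding Q_def by blast
    have QE: "\<exists>m i. a = m * y ^ i \<and> m \<in> insert 1 P \<and> (m \<in> P \<or> i > 0)" if "a \<in> Q" for a
      using that unfolding Q_def by simp
    have QK: "a \<in> K" if a: "a \<in> Q" for a
    proof -
      obtain m i where "a = m * y ^ i" "m \<in> insert 1 P" using QE[OF a] by metis
      then show ?thesis using P(1) D(1,3) torsion_free_subgroup_power(1)[OF K y(1)] by auto
    qed
    have mult: "a * b \<in> Q" if ab: "a \<in> Q" "b \<in> Q" for a b
    proof -
      obtain m i where *: "a = m * y ^ i" "m \<in> insert 1 P" "m \<in> P \<or> i > 0"
        using QE[OF ab(1)] by metis
      obtain l j where **: "b = l * y ^ j" "l \<in> insert 1 P" "l \<in> P \<or> j > 0"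
        using QE[OF ab(2)] by metis
      have "a * b = (m * l) * y ^ (i + j)" using * ** by (simp add: power_add mult_ac)
      moreover have "(m * l) * y ^ (i + j) \<in> Q" by (rule QI) (use * ** P(3) in auto)
      ultimately show ?thesis by simp
    qed
    have "P \<subseteq> Q" using QI[of _ 0] by auto
    moreover have "y \<in> Q" using QI[of 1 1] by simp
    ultimately have "Q \<notin> F" using max[of Q] y(3) by auto
    then have "1 \<in> Q" using QK mult by (auto simp: F_def)
    then obtain m i where mi: "1 = m * y ^ i" "m \<in> insert 1 P" "m \<in> P \<or> i > 0"
      using QE[of 1] by metis
    have i: "i > 0" using mi P(2) by (cases "i = 0") auto
    have "m \<noteq> 1" using mi D(7)[OF y(1) i] y(2) by auto
    then show ?thesis using mi i by auto
  qed
  have pow: "m ^ Suc i \<in> P" if "m \<in> P" for m i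
    by (induction i) (use that P(3) in auto)
  have "x \<in> P \<or> inverse x \<in> P" if x: "x \<in> K" "x \<noteq> 1" for x
  proof (rule ccontr)
    assume "\<not> (x \<in> P \<or> inverse x \<in> P)"
    then obtain m i l j where *: "m \<in> P" "i > 0" "m * x ^ i = 1" "l \<in> P" "j > 0" "l * inverse x ^ j = 1"
      using step[of x] step[of "inverse x"] x D(4) by (metis inverse_1 inverse_inverse_eq)
    have "(m * x ^ i) ^ j * (l * inverse x ^ j) ^ i = m ^ j * l ^ i"
      using D(5)[OF x(1)]
      by (simp add: power_mult_distrib power_inverse mult.commute[of i j] divide_simps flip: power_mult)
    then have "m ^ j * l ^ i = 1" using * by simp
    moreover have "m ^ j * l ^ i \<in> P" using P(3) pow[OF *(1), of "j-1"] pow[OF *(4), of "i-1"] * by simp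
    ultimately show False using P(2) by simp
  qed
  then show thesis using that P by blast
qed

lemma prime_order_root:
  assumes "prime p"
  obtains w :: "'a::{alg_closed_field,field_char_0}" where "w ^ p = 1" "w \<noteq> 1"
proof -
  let ?q = "\<Sum>i<p. monom (1::'a) i"
  have p: "p > 1" using assms prime_gt_1_nat by blast
  have "coeff ?q (p - 1) = (\<Sum>i<p. if i = p - 1 then 1 else 0)" by (auto simp: coeff_sum intro: sum.cong)
  also have "\<dots> \<noteq> 0" using p by simp
  finally have "p - 1 \<le> degree ?q" by (rule le_degree)
  then obtain w where "poly ?q w = 0" using alg_closed_imp_poly_has_root[of ?q] p by (metis One_nat_def Suc_leI diff_is_0_eq not_less order_less_le_trans zero_less_diff)
  then have w: "(\<Sum>i<p. w ^ i) = 0" by (simp add: poly_sum poly_monom)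
  have "w ^ p - 1 = (w - 1) * (\<Sum>i<p. w ^ i)" by (rule power_diff_1_eq)
  then have "w ^ p = 1" using w by simp
  moreover have "w \<noteq> 1" using w p by auto
  ultimately show thesis by (rule that)
qed

text \<open>
  Induction over the prime factors of \<open>n = p m\<close>. If \<open>p\<close> divides \<open>m\<close>, a \<open>p\<close>-th root of a primitive
  \<open>m\<close>-th root works; otherwise the product of a primitive \<open>m\<close>-th and a primitive \<open>p\<close>-th root does.
\<close>

lemma primitive_root_exists:
  assumes "n > 0"
  shows "\<exists>w :: 'a::{alg_closed_field,field_char_0}. \<forall>d. w ^ d = 1 \<longleftrightarrow> n dvd d"
  using assms
proof (induction n rule: less_induct)
  case (less n)
  show ?case
  proof (cases "n = 1")
    case True
    then show ?thesis by (intro exI[of _ 1]) auto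
  next
    case False
    then obtain p where p: "prime p" "p dvd n" using prime_factor_nat by blast
    then obtain m where m: "n = p * m" by (elim dvdE)
    have p1: "p > 1" using p prime_gt_1_nat by blast
    have "m > 0" "m < n" using m less.prems p1 by auto
    then obtain w :: 'a where w: "\<And>d. w ^ d = 1 \<longleftrightarrow> m dvd d" using less.IH by blast
    show ?thesis
    proof (cases "p dvd m")
      case True
      obtain v where v: "v ^ p = w" using nth_root_exists[of p w] p1 by auto
      show ?thesis
      proof (intro exI[of _ v] allI iffI)
        fix d assume d: "v ^ d = 1"
        have "(v ^ p) ^ d = (v ^ d) ^ p" by (simp add: mult.commute flip: power_mult)
        then have "w ^ d = 1" using d v by simp
        then obtain e where e: "d = m * e" using w by (auto elim: dvdE)
        obtain k where k: "m = p * k" using True by (elim dvdE)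
        have "w ^ (k * e) = v ^ d" unfolding v[symmetric] e k by (simp add: mult.assoc flip: power_mult)
        then have "m dvd k * e" using w d by simp
        then have "p dvd e" using k \<open>m > 0\<close> by (auto simp: mult.commute)
        then show "n dvd d" using m e by (simp add: mult.commute mult_dvd_mono)
      next
        fix d assume "n dvd d"
        then obtain e where "d = p * (m * e)" using m by (metis dvdE mult.assoc)
        then show "v ^ d = 1" using v w[of "m * e"] by (simp add: power_mult)
      qed
    next
      case False
      obtain z :: 'a where z: "z ^ p = 1" "z \<noteq> 1" using prime_order_root[OF p(1)] by blast
      have copr: "coprime p m" using False p(1) prime_imp_coprime by blast
      have zd: "p dvd d" if "z ^ d = 1" for d
      proof (rule ccontr)
        assume "\<not> p dvd d"
        then have "coprime d p" using p(1) prime_imp_coprime coprime_commute by blast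
        moreover have "d > 0" using \<open>\<not> p dvd d\<close> by (intro Nat.gr0I) auto
        ultimately obtain x y where "d * x = p * y + 1"
          using bezout_nat[of d p] by auto
        then have "z ^ (d * x) = z ^ (p * y) * z" by simp
        then show False using z that by (simp add: power_mult)
      qed
      show ?thesis
      proof (intro exI[of _ "w * z"] allI iffI)
        fix d assume d: "(w * z) ^ d = 1"
        have "(w * z) ^ (d * p) = 1" using d by (simp add: power_mult)
        moreover have "z ^ (d * p) = 1" using z by (simp add: power_mult mult.commute[of d])
        ultimately have "w ^ (d * p) = 1" by (simp add: power_mult_distrib)
        then have "m dvd d" using w copr by (simp add: coprime_dvd_mult_left_iff coprime_commute)
        then have "w ^ d = 1" using w by simp
        then have "p dvd d" using d zd by (simp add: power_mult_distrib)
        then show "n dvd d" using \<open>m dvd d\<close> copr m by (simp add: divides_mult)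
      next
        fix d assume "n dvd d"
        then have "m dvd d" "p dvd d" using m by (auto intro: dvd_mult_left dvd_mult_right)
        then have "w ^ d = 1" "z ^ d = 1" using w z by (auto simp: power_mult elim!: dvdE)
        then show "(w * z) ^ d = 1" by (simp add: power_mult_distrib)
      qed
    qed
  qed
qed

text \<open>
  The \<open>n\<close> distinct powers of \<open>w\<close> already exhaust the roots of \<open>X\<^sup>n - 1\<close>.
\<close>

lemma root_of_unity_eq_power:
  fixes w x :: "'a::field"
  assumes "n > 0" and w: "\<And>d. w ^ d = 1 \<longleftrightarrow> n dvd d" and x: "x ^ n = 1"
  obtains i where "i < n" "x = w ^ i"
proof -
  let ?q = "monom 1 n - 1 :: 'a poly"
  have q: "poly ?q y = y ^ n - 1" for y by (simp add: poly_monom)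
  have w0: "w \<noteq> 0" using w[of n] assms(1) by (auto simp: power_0_left)
  have q0: "?q \<noteq> 0" 
  proof
    assume "?q = 0"
    then have "poly ?q 0 = 0" by simp
    then show False using assms(1) unfolding q by (simp add: power_0_left)
  qed
  have deg: "degree ?q \<le> n" by (rule degree_diff_le) (auto simp: degree_monom_le)
  have inj: "inj_on ((^) w) {..<n}"
  proof (rule linorder_inj_onI')
    fix i j assume ij: "i \<in> {..<n}" "j \<in> {..<n}" "i < j"
    show "w ^ i \<noteq> w ^ j"
    proof
      assume "w ^ i = w ^ j"
      also have "w ^ j = w ^ i * w ^ (j - i)" using ij by (simp flip: power_add)
      finally have "w ^ (j - i) = 1" using w0 by simp
      then have "n dvd j - i" using w by simp
      then show False using ij by (auto dest: dvd_imp_le)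
    qed
  qed
  have sub: "(^) w ` {..<n} \<subseteq> {y. poly ?q y = 0}"
  proof clarify
    fix i
    have "(w ^ i) ^ n = (w ^ n) ^ i" by (simp add: mult.commute flip: power_mult)
    then show "poly ?q (w ^ i) = 0" unfolding q using w[of n] by simp
  qed
  have "card {y. poly ?q y = 0} \<le> n" using card_poly_roots_bound[OF q0] deg by simp
  moreover have "card ((^) w ` {..<n}) = n" using card_image[OF inj] by simp
  ultimately have "(^) w ` {..<n} = {y. poly ?q y = 0}"
    using sub poly_roots_finite[OF q0] by (intro card_seteq) auto
  then have "x \<in> (^) w ` {..<n}" using q x by simp
  then show thesis using that by auto
qed

text \<open>
  The multiplicative group of the field can be ordered cyclically. Any finitely many of its elements
  lie in a subgroup \<open>Z/M \<times> K\<close>, where \<open>K\<close> is an ordered group and \<open>Z/M\<close> consists of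
  roots of unity. It is the quotient of \<open>Z \<times> K\<close>, ordered lexicographically, by the
  multiples of \<open>(M, 1)\<close>. Every \<open>x \<noteq> 1\<close> has exactly one
  representative strictly between \<open>(0, 1)\<close> and \<open>(M, 1)\<close>. For a product, either the
  representatives add up, and both factors are smaller than the product, or the sum wraps around
  once, and both factors are larger. Cyclicity of the finite groups of roots of unity is essential:
  \<open>sl\<^sub>2\<close> has a grading by \<open>Z/2 \<times> Z/2\<close> without component of degree zero, although
  it is not solvable.
\<close>

lemma cyclic_rank:
  fixes S :: "'a::{alg_closed_field,field_char_0} set"
  assumes S: "finite S" "0 \<notin> S" "1 \<notin> S"
  obtains r :: "'a \<Rightarrow> nat" where "\<And>x y. x \<in> S \<Longrightarrow> y \<in> S \<Longrightarrow> x * y \<in> S \<Longrightarrow>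
     (r x < r (x * y) \<and> r y < r (x * y)) \<or> (r (x * y) < r x \<and> r (x * y) < r y)"
proof -
  obtain K :: "'a set" where K: "torsion_free_subgroup K"
    and KT: "\<And>x. x \<noteq> 0 \<Longrightarrow> \<exists>k\<in>K. \<exists>z n. n > 0 \<and> z ^ n = 1 \<and> x = k * z"
    using torsion_complement by blast
  note D = torsion_free_subgroupD[OF K]
  obtain P where P: "P \<subseteq> K" "1 \<notin> P" "\<And>x y. x \<in> P \<Longrightarrow> y \<in> P \<Longrightarrow> x * y \<in> P"
    "\<And>x. x \<in> K \<Longrightarrow> x \<noteq> 1 \<Longrightarrow> x \<in> P \<or> inverse x \<in> P"
    using torsion_free_orderable[OF K] by metis
  have "\<forall>x\<in>S. \<exists>k z n. k \<in> K \<and> n > 0 \<and> z ^ n = 1 \<and> x = k * z" using KT S(2) by metis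
  then obtain k z n where kzn: "\<And>x. x \<in> S \<Longrightarrow> k x \<in> K \<and> n x > 0 \<and> z x ^ n x = 1 \<and> x = k x * z x"
    by metis
  define M where "M = (\<Prod>x\<in>S. n x :: nat)"
  have M: "M > 0" unfolding M_def by (rule prod_pos) (use kzn in auto)
  have zM: "z x ^ M = 1" if "x \<in> S" for x
  proof -
    have "n x dvd M" unfolding M_def using S(1) that by (rule dvd_prodI)
    then obtain q where "M = n x * q" by (elim dvdE)
    then show ?thesis using kzn[OF that] by (simp add: power_mult)
  qed
  obtain w :: 'a where w: "\<And>d. w ^ d = 1 \<longleftrightarrow> M dvd d" using primitive_root_exists[OF M] by blast
  have w0: "w \<noteq> 0" using w[of M] M by (auto simp: power_0_left)
  have "\<exists>i k. x = k * w ^ i \<and> k \<in> K \<and> i \<le> M \<and> (i = 0 \<longrightarrow> k \<in> P) \<and> (i = M \<longrightarrow> inverse k \<in> P)"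
    if x: "x \<in> S" for x
  proof -
    obtain i where i: "i < M" "z x = w ^ i" using root_of_unity_eq_power[OF M w zM[OF x]] by metis
    have xk: "x = k x * w ^ i" "k x \<in> K" using kzn[OF x] i by auto
    show ?thesis
    proof (cases "i = 0 \<and> k x \<notin> P")
      case False
      then show ?thesis using xk i by (intro exI[of _ i] exI[of _ "k x"]) auto
    next
      case True
      then have "k x = x" using xk by simp
      then have "k x \<noteq> 1" using x S(3) by auto
      then have "inverse (k x) \<in> P" using P(4)[OF xk(2)] True by blast
      moreover have "w ^ M = 1" using w by simp
      ultimately show ?thesis using True xk M by (intro exI[of _ M] exI[of _ "k x"]) auto
    qed
  qed
  then obtain i c where ic: "\<And>x. x \<in> S \<Longrightarrow> x = c x * w ^ i x \<and> c x \<in> K \<and> i x \<le> M \<and>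
      (i x = 0 \<longrightarrow> c x \<in> P) \<and> (i x = M \<longrightarrow> inverse (c x) \<in> P)" by metis
  \<comment> \<open>The lexicographic order on the representatives \<open>(i x, c x)\<close>.\<close>
  define lt where "lt x y \<longleftrightarrow> i x < i y \<or> (i x = i y \<and> c y / c x \<in> P)" for x y
  have trans: "lt x z" if "lt x y" "lt y z" "y \<in> S" for x y z
  proof -
    have "c y \<noteq> 0" using ic[OF that(3)] D(5) by blast
    then have "c y / c x * (c z / c y) = c z / c x" by simp
    then show ?thesis using that P(3)[of "c y / c x" "c z / c y"] unfolding lt_def by auto
  qed
  have irrefl: "\<not> lt x x" if "x \<in> S" for x
    using ic[OF that] D(5)[of "c x"] P(2) by (auto simp: lt_def)
  define r where "r x = card {y\<in>S. lt y x}" for x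
  have mono: "r x < r y" if "lt x y" "x \<in> S" for x y
    unfolding r_def
  proof (rule psubset_card_mono)
    have "{y\<in>S. lt y x} \<subseteq> {z\<in>S. lt z y}" using trans that by blast
    moreover have "x \<in> {z\<in>S. lt z y}" "x \<notin> {y\<in>S. lt y x}" using that irrefl by auto
    ultimately show "{y\<in>S. lt y x} \<subset> {z\<in>S. lt z y}" by blast
  qed (use S(1) in simp)
  show thesis
  proof (rule that[of r])
    fix x y assume x: "x \<in> S" and y: "y \<in> S" and xy: "x * y \<in> S"
    define t where "t = x * y"
    have t: "t \<in> S" using xy by (simp add: t_def)
    note cK = ic[OF x] ic[OF y] ic[OF t]
    have c0: "c x \<noteq> 0" "c y \<noteq> 0" "c t \<noteq> 0" using cK D(5) by auto
    have "c t * w ^ i t = (c x * w ^ i x) * (c y * w ^ i y)" using cK t_def by metis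
    then have "c t * w ^ i t = c x * c y * w ^ (i x + i y)" by (simp add: power_add mult_ac)
    then have eq: "c x * c y / c t * w ^ (i x + i y) = w ^ i t" using c0 by (simp add: field_simps)
    have wM: "(w ^ d) ^ M = 1" for d using w[of "d * M"] by (simp add: power_mult)
    have "(c x * c y / c t) ^ M = 1"
      using arg_cong[OF eq, of "\<lambda>u. u ^ M"] unfolding power_mult_distrib wM by simp
    then have "c x * c y / c t = 1" by (intro D(7)[OF D(6)[OF D(3)] M]) (use cK in blast)+
    then have ct: "c t = c x * c y" using c0 by simp
    then have weq: "w ^ (i x + i y) = w ^ i t" using eq c0 by simp
    have "int M dvd int (i x + i y) - int (i t)"
    proof -
      have *: "M dvd b - a" if "w ^ a = w ^ b" "a \<le> b" for a b
      proof -
        have "w ^ a * w ^ (b - a) = w ^ b" using that(2) by (simp flip: power_add)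
        then have "w ^ a * w ^ (b - a) = w ^ a * 1" using that(1) by simp
        then show ?thesis using w w0 by simp
      qed
      show ?thesis
      proof (cases "i t \<le> i x + i y")
        case True
        then have "int (i x + i y) - int (i t) = int (i x + i y - i t)" by simp
        then show ?thesis using *[OF weq[symmetric] True] by (simp only: int_dvd_int_iff)
      next
        case False
        then have "int (i x + i y) - int (i t) = - int (i t - (i x + i y))" by simp
        then show ?thesis using *[OF weq] False by (simp only: dvd_minus_iff int_dvd_int_iff)
      qed
    qed
    then obtain q where q: "int (i x) + int (i y) - int (i t) = int M * q" by (auto elim: dvdE)
    have le: "i x \<le> M" "i y \<le> M" "i t \<le> M" using cK by auto
    have "int M * q < int M * 3" "int M * (-2) < int M * q" using q le M by linarith+
    then have "q < 3" "-2 < q" using M by (simp_all only: mult_less_cancel_left_pos[of "int M"] of_nat_0_less_iff)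
    \<comment> \<open>The extreme values of \<open>q\<close> force all three representatives to the ends of the interval
      and contradict the positivity conditions there.\<close>
    then consider "q = -1" | "q = 0" | "q = 1" | "q = 2" by linarith
    then have "lt x t \<and> lt y t \<or> lt t x \<and> lt t y"
    proof cases
      case 1
      then have "int (i x) + int (i y) - int (i t) = - int M" using q by simp
      then have "i x = 0" "i y = 0" "i t = M" using le by linarith+
      then have "c x * c y \<in> P" "inverse (c x * c y) \<in> P" using cK ct P(3) by auto
      then have "c x * c y * inverse (c x * c y) \<in> P" by (rule P(3))
      moreover have "c x * c y * inverse (c x * c y) = 1" by (rule right_inverse) (use c0 in simp)
      ultimately show ?thesis using P(2) by metis
    next
      case 2
      then have "int (i x) + int (i y) - int (i t) = 0" using q by simp
      then have it: "i t = i x + i y" by linarith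
      have "lt x t" using cK it ct c0 by (cases "i y = 0") (auto simp: lt_def)
      moreover have "lt y t" using cK it ct c0 by (cases "i x = 0") (auto simp: lt_def)
      ultimately show ?thesis by blast
    next
      case 3
      then have "int (i x) + int (i y) - int (i t) = int M" using q by simp
      then have it: "i t + M = i x + i y" by linarith
      have dv: "c x / c t = inverse (c y)" "c y / c t = inverse (c x)"
        using ct c0 by (simp_all add: field_simps)
      have "lt t x" using cK it dv le by (cases "i y = M") (auto simp: lt_def)
      moreover have "lt t y" using cK it dv le by (cases "i x = M") (auto simp: lt_def)
      ultimately show ?thesis by blast
    next
      case 4
      then have "int (i x) + int (i y) - int (i t) = int M * 2" using q by simp
      then have "i x = M" "i y = M" "i t = 0" using le by linarith+
      then have "inverse (c x) * inverse (c y) \<in> P" "c x * c y \<in> P" using cK ct P(3) by auto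
      then have "inverse (c x) * inverse (c y) * (c x * c y) \<in> P" by (rule P(3))
      moreover have "inverse (c x) * inverse (c y) * (c x * c y) = 1"
        using c0 by (metis inverse_mult_distrib left_inverse mult_eq_0_iff)
      ultimately show ?thesis using P(2) by metis
    qed
    then show "(r x < r (x * y) \<and> r y < r (x * y)) \<or> (r (x * y) < r x \<and> r (x * y) < r y)"
      using mono x y t unfolding t_def by blast
  qed
qed

section \<open>Perfect graded Lie algebras\<close>

context lie_algebra
begin

lemma bracket_simps:
  "bracket 0 z = 0" "bracket z 0 = 0"
  "bracket (x + y) z = bracket x z + bracket y z" "bracket z (x + y) = bracket z x + bracket z y"
  "bracket (x - y) z = bracket x z - bracket y z" "bracket z (x - y) = bracket z x - bracket z y"
  "bracket (scale c x) z = scale c (bracket x z)" "bracket z (scale c x) = scale c (bracket z x)"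
proof -
  interpret a: Vector_Spaces.linear scale scale "\<lambda>x. bracket x y" for y by (rule linear_left)
  interpret b: Vector_Spaces.linear scale scale "bracket y" for y by (rule linear_right)
  show "bracket 0 z = 0" "bracket z 0 = 0"
  "bracket (x + y) z = bracket x z + bracket y z" "bracket z (x + y) = bracket z x + bracket z y"
  "bracket (x - y) z = bracket x z - bracket y z" "bracket z (x - y) = bracket z x - bracket z y"
  "bracket (scale c x) z = scale c (bracket x z)" "bracket z (scale c x) = scale c (bracket z x)"
    by (simp_all add: a.add b.add a.diff b.diff a.scale b.scale a.zero b.zero)
qed

lemma bracket_anticomm: "bracket x y = - bracket y x"
proof -
  have "bracket (x + y) (x + y) = bracket x y + bracket y x"
    unfolding bracket_simps(3,4) alternating[of x] alternating[of y] by (simp add: add.commute)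
  then have "bracket x y + bracket y x = 0" unfolding alternating by simp
  then show ?thesis by (simp only: eq_neg_iff_add_eq_0)
qed

lemma bracket_bracket_left: "bracket (bracket x y) z = bracket x (bracket y z) - bracket y (bracket x z)"
proof -
  have *: "bracket y (bracket z x) = - bracket y (bracket x z)"
    using bracket_simps(6)[of y 0 "bracket x z"] by (subst bracket_anticomm[of z x]) (simp add: bracket_simps)
  show ?thesis
    using jacobi[of x y z] unfolding * bracket_anticomm[of z "bracket x y"] by (simp add: algebra_simps)
qed

inductive_set subalgebra_generated :: "'v set \<Rightarrow> 'v set" for Y where
  base: "y \<in> Y \<Longrightarrow> y \<in> subalgebra_generated Y"
| zero: "0 \<in> subalgebra_generated Y"
| add: "x \<in> subalgebra_generated Y \<Longrightarrow> y \<in> subalgebra_generated Y \<Longrightarrow> x + y \<in> subalgebra_generated Y"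
| scale: "x \<in> subalgebra_generated Y \<Longrightarrow> scale c x \<in> subalgebra_generated Y"
| bracket: "x \<in> subalgebra_generated Y \<Longrightarrow> y \<in> subalgebra_generated Y \<Longrightarrow>
    bracket x y \<in> subalgebra_generated Y"

lemma subspace_subalgebra_generated: "subspace (subalgebra_generated Y)"
  by (rule subspaceI) (fact subalgebra_generated.intros)+

lemma subalgebra_generated_minimal:
  assumes "Y \<subseteq> subalgebra_generated Z"
  shows "subalgebra_generated Y \<subseteq> subalgebra_generated Z"
proof
  fix x assume "x \<in> subalgebra_generated Y"
  then show "x \<in> subalgebra_generated Z"
    by induction (use assms in \<open>auto intro: subalgebra_generated.intros\<close>)
qed

lemma subalgebra_generated_empty: "subalgebra_generated {} = {0}"
proof -
  have "x = 0" if "x \<in> subalgebra_generated {}" for x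
    using that by induction (auto simp: bracket_simps)
  then show ?thesis using subalgebra_generated.zero by blast
qed

text \<open>
  The action of a subalgebra on a module is determined by its generators: by the Jacobi identity,
  \<open>[[x, y], z] = [x, [y, z]] - [y, [x, z]]\<close>, so the subalgebra maps a module into the span of the
  images under the generators alone.
\<close>

lemma bracket_subalgebra_generated:
  assumes N: "\<And>x y. x \<in> N \<Longrightarrow> y \<in> N \<Longrightarrow> bracket x y \<in> N" and YN: "subalgebra_generated Y \<subseteq> N"
    and u: "u \<in> subalgebra_generated Y" and z: "z \<in> N"
  shows "bracket u z \<in> span {bracket y z | y z. y \<in> Y \<and> z \<in> N}"
  using u z
proof (induction arbitrary: z)
  case (base y)
  then show ?case by (intro span_base) blast
next
  case (bracket x y)
  have "bracket y z \<in> N" "bracket x z \<in> N" using bracket YN N by blast+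
  then show ?case unfolding bracket_bracket_left using bracket.IH by (intro span_diff)
qed (auto simp: bracket_simps span_zero span_add span_scale)

end

context vector_space
begin

lemma span_UN_eq_sum:
  assumes "finite T" "x \<in> span (\<Union>t\<in>T. D t)"
  shows "\<exists>f. (\<forall>t\<in>T. f t \<in> span (D t)) \<and> x = (\<Sum>t\<in>T. f t)"
  using assms
proof (induction T arbitrary: x rule: finite_induct)
  case empty
  then show ?case by simp
next
  case (insert a T)
  then obtain u v where uv: "x = u + v" "u \<in> span (D a)" "v \<in> span (\<Union>t\<in>T. D t)"
    by (auto simp: span_Un)
  then obtain f where f: "\<forall>t\<in>T. f t \<in> span (D t)" "v = (\<Sum>t\<in>T. f t)" using insert.IH by blast
  have "(\<Sum>t\<in>T. (f(a := u)) t) = (\<Sum>t\<in>T. f t)" using insert.hyps by (intro sum.cong) auto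
  then show ?case using insert.hyps uv f by (intro exI[of _ "f(a := u)"]) auto
qed

text \<open>
  In a direct sum, an element of the component \<open>C t\<close> that is a sum of elements of the
  spans of \<open>D i \<subseteq> C i\<close> has only its \<open>t\<close>-th summand.
\<close>

lemma span_UN_component:
  assumes T: "finite T" and t: "t \<in> T" and sub: "\<And>i. subspace (C i)" and D: "\<And>i. D i \<subseteq> C i"
    and indep: "\<And>x. (\<forall>i\<in>T. x i \<in> C i) \<Longrightarrow> (\<Sum>i\<in>T. x i) = 0 \<Longrightarrow> \<forall>i\<in>T. x i = 0"
    and x: "x \<in> C t" "x \<in> span (\<Union>i\<in>T. D i)"
  shows "x \<in> span (D t)"
proof -
  obtain f where f: "\<forall>i\<in>T. f i \<in> span (D i)" "x = (\<Sum>i\<in>T. f i)"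
    using span_UN_eq_sum[OF T x(2)] by blast
  have DC: "span (D i) \<subseteq> C i" for i using D sub by (rule span_minimal)
  let ?g = "\<lambda>i. f i - (if i = t then x else 0)"
  have "\<forall>i\<in>T. ?g i \<in> C i" using f(1) DC x(1) by (auto intro!: subspace_diff[OF sub] subspace_0[OF sub])
  moreover have "(\<Sum>i\<in>T. ?g i) = 0" using T t f(2) by (simp add: sum_subtractf)
  ultimately have "\<forall>i\<in>T. ?g i = 0" by (rule indep)
  then have "f t = x" using t by force
  then show ?thesis using f(1) t by auto
qed

lemma span_UN_finite:
  assumes "x \<in> span (\<Union>i. C i)"
  shows "\<exists>S. finite S \<and> x \<in> span (\<Union>i\<in>S. C i)"
  using assms
proof (induction rule: span_induct_alt)
  case base
  then show ?case by (intro exI[of _ "{}"]) auto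
next
  case (step c x y)
  then obtain i S where *: "x \<in> C i" "finite S" "y \<in> span (\<Union>i\<in>S. C i)" by blast
  have "x \<in> span (\<Union>i\<in>insert i S. C i)" using * by (intro span_base) auto
  moreover have "y \<in> span (\<Union>i\<in>insert i S. C i)" using * span_mono[of "\<Union>i\<in>S. C i" "\<Union>i\<in>insert i S. C i"] by auto
  ultimately show ?case using * by (intro exI[of _ "insert i S"]) (auto intro: span_add span_scale)
qed

end

text \<open>
  This is the argument behind Kreknin's theorem on gradings whose component of degree zero is
  trivial. By induction on \<open>k\<close>, the components of rank at least \<open>k\<close> generate \<open>N\<close>. Indeed, if
  they do, then \<open>N = [N, N]\<close> is spanned by brackets whose first entry lies in such a component, by
  \<open>bracket_subalgebra_generated\<close>. A bracket of degree \<open>t\<close> with \<open>t\<close> of rank \<open>k\<close> then has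
  both entries of rank greater than \<open>k\<close>, since both ranks lie on the same side of \<open>k\<close>. Hence the
  components of rank \<open>k\<close> are in the subalgebra generated by those of larger rank. Beyond
  the largest rank there are no generators left, so \<open>N\<close> is trivial.
\<close>

lemma (in lie_algebra) graded_perfect_trivial:
  fixes C :: "'i::times \<Rightarrow> 'v set" and r :: "'i \<Rightarrow> nat"
  assumes S: "finite S"
    and sub: "\<And>i. subspace (C i)"
    and indep: "\<And>T x. finite T \<Longrightarrow> \<forall>i\<in>T. x i \<in> C i \<Longrightarrow> (\<Sum>i\<in>T. x i) = 0 \<Longrightarrow> \<forall>i\<in>T. x i = 0"
    and N: "N = span (\<Union>i\<in>S. C i)"
    and perfect: "N = span {bracket x y | x y. x \<in> N \<and> y \<in> N}"
    and mult: "\<And>i j x y. x \<in> C i \<Longrightarrow> y \<in> C j \<Longrightarrow> bracket x y \<in> C (i * j)"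
    and r: "\<And>i j. i \<in> S \<Longrightarrow> j \<in> S \<Longrightarrow> i * j \<in> S \<Longrightarrow>
      (r i < r (i * j) \<and> r j < r (i * j)) \<or> (r (i * j) < r i \<and> r (i * j) < r j)"
  shows "N = {0}"
proof -
  define Y where "Y k = (\<Union>i\<in>{i\<in>S. r i \<ge> k}. C i)" for k
  let ?G = "\<lambda>k. subalgebra_generated (Y k)"
  have subN: "subspace N" unfolding N by simp
  have NN: "bracket x y \<in> N" if "x \<in> N" "y \<in> N" for x y
    by (subst perfect, rule span_base) (use that in blast)
  have CN: "C i \<subseteq> N" if "i \<in> S" for i
    unfolding N using that by (auto intro: span_base)
  have GN: "?G k \<subseteq> N" for k
  proof
    fix x assume "x \<in> ?G k"
    then show "x \<in> N"
      by induction (use CN NN subN in \<open>auto simp: Y_def intro: subspace_0 subspace_add subspace_scale\<close>)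
  qed
  have gen: "N \<subseteq> ?G k" for k
  proof (induction k)
    case 0
    have "(\<Union>i\<in>S. C i) \<subseteq> ?G 0" by (auto simp: Y_def intro: subalgebra_generated.base)
    then show ?case unfolding N by (rule span_minimal) (rule subspace_subalgebra_generated)
  next
    case (Suc k)
    then have G: "?G k = N" using GN by blast
    \<comment> \<open>The degrees \<open>i * j\<close> of these brackets may fall outside \<open>S\<close>; the larger index set \<open>T\<close>
      contains them all.\<close>
    define D where "D t = {bracket y z | y z i j. y \<in> C i \<and> z \<in> C j \<and> i \<in> S \<and> j \<in> S \<and> k \<le> r i \<and> i * j = t}" for t
    define T where "T = S \<union> (\<lambda>(i, j). i * j) ` (S \<times> S)"
    have T: "finite T" using S by (simp add: T_def)
    have DC: "D t \<subseteq> C t" for t using mult by (auto simp: D_def)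
    have yz: "bracket y z \<in> span (\<Union>t\<in>T. D t)" if yi: "y \<in> C i" "i \<in> S" "k \<le> r i" and z: "z \<in> N" for y z i
      using z unfolding N
    proof (induction rule: span_induct_alt)
      case base
      then show ?case by (simp add: bracket_simps span_zero)
    next
      case (step c x u)
      then obtain j where j: "j \<in> S" "x \<in> C j" by blast
      have "bracket y x \<in> D (i * j)" using yi j unfolding D_def by blast
      moreover have "i * j \<in> T" using yi j by (auto simp: T_def)
      ultimately have "bracket y x \<in> span (\<Union>t\<in>T. D t)" by (intro span_base) blast
      then show ?case using step by (auto simp: bracket_simps intro: span_add span_scale)
    qed
    have ND: "N \<subseteq> span (\<Union>t\<in>T. D t)"
    proof -
      have "bracket u z \<in> span {bracket y z | y z. y \<in> Y k \<and> z \<in> N}" if "u \<in> N" "z \<in> N" for u z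
        using bracket_subalgebra_generated[OF NN GN] that G by blast
      moreover have "span {bracket y z | y z. y \<in> Y k \<and> z \<in> N} \<subseteq> span (\<Union>t\<in>T. D t)"
        by (rule span_minimal) (use yz in \<open>auto simp: Y_def\<close>)
      ultimately have "span {bracket x y | x y. x \<in> N \<and> y \<in> N} \<subseteq> span (\<Union>t\<in>T. D t)"
        by (intro span_minimal) auto
      then show ?thesis using perfect by simp
    qed
    have "C t \<subseteq> ?G (Suc k)" if t: "t \<in> S" "k \<le> r t" for t
    proof (cases "r t = k")
      case False
      then show ?thesis using t by (auto simp: Y_def intro!: subalgebra_generated.base)
    next
      case True
      have "D t \<subseteq> ?G (Suc k)"
      proof
        fix x assume "x \<in> D t"
        then obtain y z i j where *: "x = bracket y z" "y \<in> C i" "z \<in> C j" "i \<in> S" "j \<in> S" "k \<le> r i" "i * j = t"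
          unfolding D_def by blast
        then have "k < r i" "k < r j" using r[of i j] t True by auto
        then have "y \<in> Y (Suc k)" "z \<in> Y (Suc k)" using * by (auto simp: Y_def)
        then show "x \<in> ?G (Suc k)" using * by (auto intro: subalgebra_generated.intros)
      qed
      then have "span (D t) \<subseteq> ?G (Suc k)" by (rule span_minimal) (rule subspace_subalgebra_generated)
      moreover have "C t \<subseteq> span (D t)"
      proof
        fix x assume x: "x \<in> C t"
        then have "x \<in> span (\<Union>t\<in>T. D t)" using ND CN t by blast
        then show "x \<in> span (D t)"
          using span_UN_component[where T=T and t=t and C=C and D=D] T sub DC indep[OF T] x t
          by (simp add: T_def)
      qed
      ultimately show ?thesis by blast
    qed
    then have "?G k \<subseteq> ?G (Suc k)" by (intro subalgebra_generated_minimal) (auto simp: Y_def)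
    then show ?case using G by simp
  qed
  have "Y (Suc (Max (r ` S))) = {}" using S by (auto simp: Y_def dest: Max_ge[OF finite_imageI, of S _ r] )
  then have "N \<subseteq> {0}" using gen[of "Suc (Max (r ` S))"] by (simp add: subalgebra_generated_empty)
  then show ?thesis using subspace_0[OF subN] by blast
qed

section \<open>Generalized eigenspaces\<close>

locale linear_operator = vector_space scale
  for scale :: "'k::field \<Rightarrow> 'v::ab_group_add \<Rightarrow> 'v" +
  fixes A :: "'v \<Rightarrow> 'v"
  assumes linear_A: "Vector_Spaces.linear scale scale A"
begin

lemma A_simps:
  "A 0 = 0" "A (x + y) = A x + A y" "A (x - y) = A x - A y" "A (scale c x) = scale c (A x)"
  "A (sum g I) = (\<Sum>i\<in>I. A (g i))"
proof -
  interpret Vector_Spaces.linear scale scale A by (rule linear_A)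
  show "A 0 = 0" "A (x + y) = A x + A y" "A (x - y) = A x - A y" "A (scale c x) = scale c (A x)"
    "A (sum g I) = (\<Sum>i\<in>I. A (g i))"
    by (rule zero add diff scale sum)+
qed

text \<open>
  The union of the kernels of the powers of \<open>A - l\<close>. In this inductive form, an induction on the
  exponent becomes rule induction.
\<close>

inductive_set generalized_eigenspace :: "'k \<Rightarrow> 'v set" for l where
  zero: "0 \<in> generalized_eigenspace l"
| step: "A x - scale l x \<in> generalized_eigenspace l \<Longrightarrow> x \<in> generalized_eigenspace l"

lemma generalized_eigenspace_shift:
  assumes "x \<in> generalized_eigenspace l" shows "A x - scale l x \<in> generalized_eigenspace l"
  using assms by cases (auto simp: A_simps intro: generalized_eigenspace.zero)

lemma subspace_generalized_eigenspace: "subspace (generalized_eigenspace l)"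
proof (rule subspaceI)
  show "0 \<in> generalized_eigenspace l" by (rule generalized_eigenspace.zero)
next
  fix x y assume "x \<in> generalized_eigenspace l" "y \<in> generalized_eigenspace l"
  then show "x + y \<in> generalized_eigenspace l"
  proof (induction arbitrary: y)
    case (step x)
    have "A (x + y) - scale l (x + y) = (A x - scale l x) + (A y - scale l y)"
      by (simp add: A_simps scale_right_distrib)
    then show ?case
      using step.IH[OF generalized_eigenspace_shift[OF step.prems]]
      by (intro generalized_eigenspace.step[of "x + y"]) simp
  qed simp
next
  fix c x assume "x \<in> generalized_eigenspace l"
  then show "scale c x \<in> generalized_eigenspace l"
  proof induction
    case (step x)
    have "A (scale c x) - scale l (scale c x) = scale c (A x - scale l x)"
      by (simp add: A_simps scale_right_diff_distrib mult.commute)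
    then show ?case using step.IH by (intro generalized_eigenspace.step[of "scale c x"]) simp
  qed (simp add: generalized_eigenspace.zero)
qed

lemma generalized_eigenspace_image: "x \<in> generalized_eigenspace l \<Longrightarrow> A x \<in> generalized_eigenspace l"
  using subspace_add[OF subspace_generalized_eigenspace generalized_eigenspace_shift
      subspace_scale[OF subspace_generalized_eigenspace]]
  by (metis diff_add_cancel)

lemma eigenvector_in_generalized_eigenspace:
  assumes "x \<in> generalized_eigenspace m" "A x = scale l x" "l \<noteq> m"
  shows "x = 0"
  using assms(1,2)
proof induction
  case (step x)
  have *: "A x - scale m x = scale (l - m) x" using step.prems by (simp add: scale_left_diff_distrib)
  have "scale (l - m) x = 0"
    unfolding *[symmetric]
    by (rule step.IH) (simp add: * A_simps step.prems scale_right_diff_distrib mult.commute)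
  then show ?case using assms(3) by simp
qed simp

lemma generalized_eigenspaces_disjoint:
  assumes "x \<in> generalized_eigenspace l" "x \<in> generalized_eigenspace m" "l \<noteq> m"
  shows "x = 0"
  using assms(1,2)
proof induction
  case (step x)
  have "A x - scale l x \<in> generalized_eigenspace m"
    using step.prems generalized_eigenspace_image subspace_generalized_eigenspace
    by (blast intro: subspace_diff subspace_scale)
  then have "A x = scale l x" using step.IH by simp
  then show ?case using eigenvector_in_generalized_eigenspace step.prems assms(3) by blast
qed simp

lemma generalized_eigenspace_trivial:
  assumes inj: "\<And>x. x \<in> N \<Longrightarrow> A x = scale l x \<Longrightarrow> x = 0"
    and N: "subspace N" "\<And>x. x \<in> N \<Longrightarrow> A x \<in> N" and x: "x \<in> generalized_eigenspace l" "x \<in> N"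
  shows "x = 0"
  using x
proof induction
  case (step x)
  have "A x - scale l x \<in> N" using N step.prems by (blast intro: subspace_diff subspace_scale)
  then show ?case using step.IH inj[OF step.prems] by simp
qed simp

text \<open>
  Applying \<open>A - a\<close> to a vanishing sum shortens the nilpotency of the summand for \<open>a\<close> and keeps the
  other summands in their eigenspaces, on which \<open>A - a\<close> is injective.
\<close>

lemma generalized_eigenspaces_independent:
  assumes "finite T" "\<forall>i\<in>T. x i \<in> generalized_eigenspace i" "(\<Sum>i\<in>T. x i) = 0"
  shows "\<forall>i\<in>T. x i = 0"
  using assms
proof (induction T arbitrary: x rule: finite_induct)
  case (insert a T)
  have "u \<in> generalized_eigenspace a \<Longrightarrow> (\<forall>i\<in>T. x i \<in> generalized_eigenspace i) \<Longrightarrow> u + (\<Sum>i\<in>T. x i) = 0 \<Longrightarrow> u = 0 \<and> (\<forall>i\<in>T. x i = 0)" for u x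
  proof (induction arbitrary: x rule: generalized_eigenspace.induct)
    case zero
    then show ?case using insert.IH by simp
  next
    case (step u)
    let ?y = "\<lambda>i. A (x i) - scale a (x i)"
    have yE: "\<forall>i\<in>T. ?y i \<in> generalized_eigenspace i"
      using step.prems(1) generalized_eigenspace_image subspace_generalized_eigenspace
      by (blast intro: subspace_diff subspace_scale)
    have "(A u - scale a u) + (\<Sum>i\<in>T. ?y i) = A (u + (\<Sum>i\<in>T. x i)) - scale a (u + (\<Sum>i\<in>T. x i))"
      by (simp add: A_simps sum_subtractf scale_sum_right scale_right_distrib)
    also have "\<dots> = 0" unfolding step.prems(2) by (simp add: A_simps)
    finally have "\<forall>i\<in>T. ?y i = 0" using step.IH[OF yE] by blast
    then have "\<forall>i\<in>T. x i = 0"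
      using eigenvector_in_generalized_eigenspace[where l=a] step.prems(1) insert.hyps(2) by (metis eq_iff_diff_eq_0)
    then show ?case using step.prems(2) by simp
  qed
  then show ?case using insert.prems insert.hyps by auto
qed simp

text \<open>
  On the generalized eigenspace for \<open>s\<close>, the operator \<open>A - l\<close> is \<open>s - l\<close> plus a nilpotent operator,
  hence surjective.
\<close>

lemma shift_surj_generalized_eigenspace:
  assumes "l \<noteq> s" and N: "subspace N" "\<And>x. x \<in> N \<Longrightarrow> A x \<in> N" and u: "u \<in> generalized_eigenspace s" "u \<in> N"
  shows "\<exists>v\<in>generalized_eigenspace s \<inter> N. A v - scale l v = u"
  using u
proof induction
  case zero
  show ?case using N(1) by (intro bexI[of _ 0]) (auto simp: A_simps subspace_0 generalized_eigenspace.zero)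
next
  case (step u)
  have w: "A u - scale s u \<in> N" using N step.prems by (blast intro: subspace_diff subspace_scale)
  then obtain v where v: "v \<in> generalized_eigenspace s \<inter> N" "A v - scale l v = A u - scale s u" using step.IH by blast
  let ?c = "inverse (s - l)"
  have sub: "subspace (generalized_eigenspace s \<inter> N)" using subspace_generalized_eigenspace N(1) by (rule subspace_inter)
  have "u \<in> generalized_eigenspace s \<inter> N" using step by (auto intro: generalized_eigenspace.step)
  then have "scale ?c (u - v) \<in> generalized_eigenspace s \<inter> N" using v(1) sub by (intro subspace_scale subspace_diff)
  moreover have "A (scale ?c (u - v)) - scale l (scale ?c (u - v))
      = scale ?c ((A u - scale l u) - (A v - scale l v))"
    by (simp add: A_simps scale_right_diff_distrib mult.commute)
  moreover have "(A u - scale l u) - (A v - scale l v) = scale (s - l) u"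
    unfolding v(2) by (simp add: scale_left_diff_distrib)
  ultimately show ?case using assms(1) by (intro bexI[of _ "scale ?c (u - v)"]) auto
qed

text \<open>
  If \<open>A - l\<close> maps \<open>w\<close> into the sum of the generalized eigenspaces, the summands for eigenvalues
  other than \<open>l\<close> have preimages there. Subtracting these from \<open>w\<close> leaves a vector that
  \<open>A - l\<close> maps into the generalized eigenspace for \<open>l\<close>.
\<close>

lemma span_generalized_eigenspaces_step:
  assumes N: "subspace N" "\<And>x. x \<in> N \<Longrightarrow> A x \<in> N"
    and w: "w \<in> N" "A w - scale l w \<in> span (\<Union>s. generalized_eigenspace s \<inter> N)"
  shows "w \<in> span (\<Union>s. generalized_eigenspace s \<inter> N)"
proof -
  let ?G = "span (\<Union>s. generalized_eigenspace s \<inter> N)"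
  have GN: "?G \<subseteq> N" using N(1) by (intro span_minimal) auto
  have "\<exists>v\<in>?G. \<exists>u\<in>generalized_eigenspace l \<inter> N. g = (A v - scale l v) + u" if "g \<in> ?G" for g
    using that
  proof (induction rule: span_induct_alt)
    case base
    show ?case using N(1)
      by (intro bexI[of _ 0]) (auto simp: A_simps span_zero subspace_0 generalized_eigenspace.zero)
  next
    case (step c x y)
    then obtain v u where vu: "v \<in> ?G" "u \<in> generalized_eigenspace l \<inter> N" "y = (A v - scale l v) + u" by blast
    obtain s where s: "x \<in> generalized_eigenspace s" "x \<in> N" using step by blast
    have "\<exists>v'\<in>?G. \<exists>u'\<in>generalized_eigenspace l \<inter> N. x = (A v' - scale l v') + u'"
    proof (cases "s = l")
      case True
      then show ?thesis using s by (intro bexI[of _ 0] bexI[of _ x]) (auto simp: A_simps span_zero)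
    next
      case False
      then obtain v' where v': "v' \<in> generalized_eigenspace s \<inter> N" "A v' - scale l v' = x"
        using shift_surj_generalized_eigenspace[OF _ N s, of l] by blast
      then have "v' \<in> ?G" by (intro span_base) blast
      then show ?thesis using v' N(1)
        by (intro bexI[of _ v'] bexI[of _ 0]) (auto simp: subspace_0 generalized_eigenspace.zero)
    qed
    then obtain v' u' where vu': "v' \<in> ?G" "u' \<in> generalized_eigenspace l \<inter> N" "x = (A v' - scale l v') + u'" by blast
    have "scale c x + y = (A (scale c v' + v) - scale l (scale c v' + v)) + (scale c u' + u)"
      unfolding vu(3) vu'(3)
      by (simp add: A_simps algebra_simps)
    moreover have "scale c v' + v \<in> ?G" using vu vu' by (intro span_add span_scale)
    moreover have "scale c u' + u \<in> generalized_eigenspace l \<inter> N"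
      using vu vu' subspace_inter[OF subspace_generalized_eigenspace N(1)]
      by (intro subspace_add subspace_scale)
    ultimately show ?case by blast
  qed
  then obtain v u where vu: "v \<in> ?G" "u \<in> generalized_eigenspace l \<inter> N" "A w - scale l w = (A v - scale l v) + u" using w(2) by blast
  have "A (w - v) - scale l (w - v) = (A w - scale l w) - (A v - scale l v)"
    by (simp add: A_simps scale_right_diff_distrib)
  also have "\<dots> = u" unfolding vu(3) by simp
  finally have "A (w - v) - scale l (w - v) = u" .
  then have "w - v \<in> generalized_eigenspace l" using vu(2) by (intro generalized_eigenspace.step[of "w - v"]) simp
  moreover have "w - v \<in> N" using w(1) vu(1) GN N(1) by (blast intro: subspace_diff)
  ultimately have "w - v \<in> ?G" by (intro span_base) blast
  then have "(w - v) + v \<in> ?G" using vu(1) by (rule span_add)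
  then show ?thesis by simp
qed

text \<open>
  The value at \<open>x\<close> of the operator \<open>p(A)\<close>, computed by Horner's scheme.
\<close>

definition apply_poly :: "'k poly \<Rightarrow> 'v \<Rightarrow> 'v" where
  "apply_poly p x = fold_coeffs (\<lambda>a y. scale a x + A y) p 0"

lemma apply_poly_0: "apply_poly 0 x = 0"
  by (simp add: apply_poly_def)

lemma apply_poly_pCons: "apply_poly (pCons a p) x = scale a x + A (apply_poly p x)"
  by (cases "p = 0 \<and> a = 0") (auto simp: apply_poly_def A_simps)

lemma apply_poly_add: "apply_poly (p + q) x = apply_poly p x + apply_poly q x"
  by (induction p q rule: poly_induct2)
    (simp_all add: apply_poly_0 apply_poly_pCons A_simps scale_left_distrib algebra_simps)

lemma apply_poly_smult: "apply_poly (smult c p) x = scale c (apply_poly p x)"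
  by (induction p) (simp_all add: apply_poly_0 apply_poly_pCons A_simps scale_right_distrib)

lemma apply_poly_linear_factor:
  "apply_poly ([:- l, 1:] * q) x = A (apply_poly q x) - scale l (apply_poly q x)"
proof -
  have "[:- l, 1:] * q = smult (- l) q + pCons 0 q" by simp
  then show ?thesis by (simp only: apply_poly_add apply_poly_smult apply_poly_pCons) simp
qed

lemma apply_poly_monom: "apply_poly (monom c n) x = scale c ((A ^^ n) x)"
  by (induction n) (simp_all add: monom_0 monom_Suc apply_poly_0 apply_poly_pCons A_simps)

lemma apply_poly_sum: "apply_poly (\<Sum>i\<in>I. p i) x = (\<Sum>i\<in>I. apply_poly (p i) x)"
  by (induction I rule: infinite_finite_induct) (simp_all add: apply_poly_0 apply_poly_add)

lemma apply_poly_in_subspace: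
  assumes "subspace N" "\<And>x. x \<in> N \<Longrightarrow> A x \<in> N" "x \<in> N"
  shows "apply_poly p x \<in> N"
  by (induction p) (use assms in \<open>auto simp: apply_poly_0 apply_poly_pCons intro: subspace_0 subspace_add subspace_scale\<close>)

end

text \<open>
  The iterates of \<open>v\<close> under \<open>A\<close> up to the dimension are either not distinct or linearly dependent.
\<close>

lemma (in finite_dimensional_vector_space) annihilating_poly_exists:
  assumes A: "Vector_Spaces.linear scale scale A"
  shows "\<exists>p. p \<noteq> 0 \<and> linear_operator.apply_poly scale A p v = 0"
proof -
  interpret op: linear_operator scale A by (intro linear_operator.intro linear_operator_axioms.intro vector_space_axioms A)
  let ?f = "\<lambda>i. (A ^^ i) v" and ?I = "{..dimension}"
  show ?thesis
  proof (cases "inj_on ?f ?I")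
    case False
    then obtain i j where ij: "i \<noteq> j" "?f i = ?f j" by (auto simp: inj_on_def)
    let ?p = "monom (1::'a) i + monom (-1) j"
    have "coeff ?p i = 1" using ij by simp
    then have "?p \<noteq> 0" by (metis Polynomial.coeff_0 zero_neq_one)
    moreover have "op.apply_poly ?p v = 0"
      using ij by (simp add: op.apply_poly_add op.apply_poly_monom)
    ultimately show ?thesis by blast
  next
    case True
    have "card (?f ` ?I) = Suc dimension" using card_image[OF True] by simp
    then have "dependent (?f ` ?I)"
      using independent_card_le_dim[of "?f ` ?I" UNIV] by (auto simp: dim_UNIV dimension_def)
    then obtain u where u: "\<exists>x\<in>?f ` ?I. u x \<noteq> 0" "(\<Sum>x\<in>?f ` ?I. scale (u x) x) = 0"
      by (subst (asm) dependent_finite) auto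
    let ?p = "\<Sum>i\<in>?I. monom (u (?f i)) i"
    obtain k where k: "k \<in> ?I" "u (?f k) \<noteq> 0" using u(1) by blast
    have "coeff ?p k = u (?f k)" using k by (simp add: coeff_sum)
    then have "?p \<noteq> 0" using k by (metis Polynomial.coeff_0)
    moreover have "op.apply_poly ?p v = 0"
      using u(2) by (simp add: op.apply_poly_sum op.apply_poly_monom sum.reindex[OF True])
    ultimately show ?thesis by blast
  qed
qed

text \<open>
  The linear factors of \<open>p\<close> can be removed one at a time by \<open>span_generalized_eigenspaces_step\<close>.
\<close>

lemma span_generalized_eigenspaces_of_poly:
  fixes scale :: "'k::alg_closed_field \<Rightarrow> 'v::ab_group_add \<Rightarrow> 'v"
  assumes A: "linear_operator scale A"
    and N: "module.subspace scale N" "\<And>x. x \<in> N \<Longrightarrow> A x \<in> N"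
    and w: "w \<in> N" and p: "p \<noteq> 0" "linear_operator.apply_poly scale A p w = 0"
  shows "w \<in> module.span scale (\<Union>s. linear_operator.generalized_eigenspace scale A s \<inter> N)"
proof -
  interpret linear_operator scale A by (rule A)
  let ?G = "span (\<Union>s. generalized_eigenspace s \<inter> N)"
  have "p \<noteq> 0 \<Longrightarrow> apply_poly p w \<in> ?G \<Longrightarrow> w \<in> ?G" for p
  proof (induction "degree p" arbitrary: p rule: less_induct)
    case less
    show ?case
    proof (cases "degree p = 0")
      case True
      then obtain c where c: "p = [:c:]" by (rule degree_eq_zeroE)
      have "apply_poly p w = scale c w"
        by (simp add: c A_simps apply_poly_pCons apply_poly_0)
      then have "scale (inverse c) (scale c w) \<in> ?G" using less.prems by (metis span_scale)
      then show ?thesis using c less.prems(1) by simp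
    next
      case False
      then obtain l where "poly p l = 0" using alg_closed_imp_poly_has_root[of p] by auto
      then obtain q where q: "p = [:- l, 1:] * q" by (auto simp: poly_eq_0_iff_dvd elim: dvdE)
      have q0: "q \<noteq> 0" using less.prems(1) q by auto
      have "degree p = Suc (degree q)" 
        using q q0 degree_mult_eq[of "[:- l, 1:]" q] by (simp del: mult_pCons_left)
      moreover have "apply_poly q w \<in> ?G"
        by (rule span_generalized_eigenspaces_step[OF N])
          (use less.prems(2) apply_poly_in_subspace[OF N w] in \<open>auto simp: q apply_poly_linear_factor simp del: mult_pCons_left\<close>)
      ultimately show ?thesis using less.hyps[of q] q0 by simp
    qed
  qed
  then show ?thesis using p span_zero by simp
qed

text \<open>
  An automorphism grades the Lie algebra by its eigenvalues, multiplicatively, because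
  \<open>(A - l m)[x, y] = [(A - l) x, (A - m) y] + m [(A - l) x, y] + l [x, (A - m) y]\<close>.
\<close>

lemma bracket_generalized_eigenspaces:
  fixes scale :: "'k::field \<Rightarrow> 'v::ab_group_add \<Rightarrow> 'v"
  assumes L: "lie_algebra scale bracket" and A: "linear_operator scale A"
    and hom: "\<And>x y. A (bracket x y) = bracket (A x) (A y)"
    and x: "x \<in> linear_operator.generalized_eigenspace scale A l"
    and y: "y \<in> linear_operator.generalized_eigenspace scale A m"
  shows "bracket x y \<in> linear_operator.generalized_eigenspace scale A (l * m)"
proof -
  interpret lie_algebra scale bracket by (rule L)
  interpret linear_operator scale A by (rule A)
  show ?thesis
    using x y
  proof (induction arbitrary: y)
    case zero
    show ?case by (simp add: bracket_simps generalized_eigenspace.zero)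
  next
    case (step x)
    note IHx = step.IH
    from step.prems show ?case
    proof induction
      case zero
      show ?case by (simp add: bracket_simps generalized_eigenspace.zero)
    next
      case (step y)
      let ?x = "A x - scale l x" and ?y = "A y - scale m y"
      have "A (bracket x y) - scale (l * m) (bracket x y)
        = bracket ?x ?y + scale m (bracket ?x y) + scale l (bracket x ?y)"
        by (simp add: hom bracket_simps scale_right_diff_distrib algebra_simps)
      moreover have "bracket ?x ?y \<in> generalized_eigenspace (l * m)"
        using step.hyps by (rule IHx)
      moreover have "bracket ?x y \<in> generalized_eigenspace (l * m)"
        using generalized_eigenspace.step[OF step.hyps] by (rule IHx)
      ultimately have "A (bracket x y) - scale (l * m) (bracket x y) \<in> generalized_eigenspace (l * m)"
        using step.IH subspace_generalized_eigenspace by (simp add: subspace_add subspace_scale)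
      then show ?case by (rule generalized_eigenspace.step)
    qed
  qed
qed

text \<open>
  The generalized eigenspaces of \<open>A\<close> in \<open>N\<close> form a grading to which \<open>graded_perfect_trivial\<close>
  applies. The eigenvalues 0 and 1, for which \<open>cyclic_rank\<close> has no rank, are excluded by
  the two injectivity assumptions.
\<close>

lemma perfect_fixed_point_free_trivial:
  fixes scale :: "'k::{alg_closed_field,field_char_0} \<Rightarrow> 'v::ab_group_add \<Rightarrow> 'v"
  assumes L: "lie_algebra scale br" and A: "linear_operator scale A"
    and hom: "\<And>x y. A (br x y) = br (A x) (A y)"
    and AN: "\<And>x. x \<in> N \<Longrightarrow> A x \<in> N"
    and perfect: "N = module.span scale {br x y | x y. x \<in> N \<and> y \<in> N}"
    and F: "finite F" "N = module.span scale F"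
      "\<And>x. x \<in> F \<Longrightarrow> \<exists>p. p \<noteq> 0 \<and> linear_operator.apply_poly scale A p x = 0"
    and inj: "\<And>x. x \<in> N \<Longrightarrow> A x = 0 \<Longrightarrow> x = 0" "\<And>x. x \<in> N \<Longrightarrow> A x = x \<Longrightarrow> x = 0"
  shows "N = {0}"
proof -
  interpret lie_algebra scale br by (rule L)
  interpret linear_operator scale A by (rule A)
  have subN: "subspace N" unfolding F(2) by simp
  define C where "C l = generalized_eigenspace l \<inter> N" for l
  have subC: "subspace (C l)" for l
    unfolding C_def using subspace_generalized_eigenspace subN by (rule subspace_inter)
  have "\<exists>S. finite S \<and> x \<in> span (\<Union>s\<in>S. C s)" if "x \<in> F" for x
  proof -
    have "x \<in> span (\<Union>s. C s)"
      using span_generalized_eigenspaces_of_poly[OF A subN AN] F(3)[OF that] that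
      unfolding C_def F(2) by (metis span_base)
    then show ?thesis by (rule span_UN_finite)
  qed
  then obtain T where T: "\<And>x. x \<in> F \<Longrightarrow> finite (T x) \<and> x \<in> span (\<Union>s\<in>T x. C s)" by metis
  define S where "S = (\<Union>x\<in>F. T x) - {0, 1}"
  have S: "finite S" "0 \<notin> S" "1 \<notin> S" using F(1) T by (auto simp: S_def)
  have C01: "C 0 \<subseteq> {0}" "C 1 \<subseteq> {0}"
  proof -
    have "x = 0" if "x \<in> C 0" for x
      by (rule generalized_eigenspace_trivial[of N 0]) (use that inj(1) subN AN in \<open>auto simp: C_def\<close>)
    moreover have "x = 0" if "x \<in> C 1" for x
      by (rule generalized_eigenspace_trivial[of N 1]) (use that inj(2) subN AN in \<open>auto simp: C_def\<close>)
    ultimately show "C 0 \<subseteq> {0}" "C 1 \<subseteq> {0}" by blast+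
  qed
  have "x \<in> span (\<Union>s\<in>S. C s)" if "x \<in> F" for x
  proof -
    have "(\<Union>s\<in>T x. C s) \<subseteq> span (\<Union>s\<in>S. C s)"
    proof safe
      fix s y assume s: "s \<in> T x" "y \<in> C s"
      show "y \<in> span (\<Union>s\<in>S. C s)"
      proof (cases "s \<in> S")
        case True
        then show ?thesis using s by (intro span_base) blast
      next
        case False
        then have "y = 0" using s that C01 by (auto simp: S_def)
        then show ?thesis by (simp add: span_zero)
      qed
    qed
    then have "span (\<Union>s\<in>T x. C s) \<subseteq> span (\<Union>s\<in>S. C s)" by (intro span_minimal) auto
    then show ?thesis using T[OF that] by blast
  qed
  then have "N \<subseteq> span (\<Union>s\<in>S. C s)" unfolding F(2) by (intro span_minimal) auto
  moreover have "span (\<Union>s\<in>S. C s) \<subseteq> N" using subN by (intro span_minimal) (auto simp: C_def)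
  ultimately have N: "N = span (\<Union>s\<in>S. C s)" by blast
  obtain r :: "'k \<Rightarrow> nat" where r: "\<And>x y. x \<in> S \<Longrightarrow> y \<in> S \<Longrightarrow> x * y \<in> S \<Longrightarrow>
     (r x < r (x * y) \<and> r y < r (x * y)) \<or> (r (x * y) < r x \<and> r (x * y) < r y)"
    using cyclic_rank[OF S] by blast
  show ?thesis
  proof (rule graded_perfect_trivial[OF S(1) subC _ N perfect _ r])
    show "\<forall>i\<in>T. x i = 0" if "finite T" "\<forall>i\<in>T. x i \<in> C i" "sum x T = 0" for T x
      using generalized_eigenspaces_independent that by (auto simp: C_def)
    show "br x y \<in> C (i * j)" if "x \<in> C i" "y \<in> C j" for i j x y
    proof -
      have "br x y \<in> N" by (subst perfect, rule span_base) (use that in \<open>auto simp: C_def\<close>)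
      moreover have "x \<in> generalized_eigenspace i" "y \<in> generalized_eigenspace j"
        using that unfolding C_def by simp_all
      then have "br x y \<in> generalized_eigenspace (i * j)"
        using bracket_generalized_eigenspaces[of scale br A, OF L A hom] by metis
      ultimately show ?thesis unfolding C_def by (metis IntI)
    qed
  qed
qed

section \<open>Extension of scalars to the algebraic closure\<close>

text \<open>
  The extension of a vector space with a basis to a larger field \<open>L\<close> is modelled by the
  \<open>L\<close>-valued functions, a vector being embedded by its coordinates. Functions are treated as vectors
  from here on, so the pointwise rewrite rules for them are disabled.
\<close>

declare plus_fun_apply [simp del] zero_fun_apply [simp del]

definition extended_scale :: "'l::field \<Rightarrow> ('v \<Rightarrow> 'l) \<Rightarrow> 'v \<Rightarrow> 'l" where
  "extended_scale c f = (\<lambda>b. c * f b)"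

global_interpretation ext: vector_space extended_scale
  by unfold_locales (auto simp: extended_scale_def fun_eq_iff plus_fun_apply algebra_simps)

context finite_dimensional_vector_space
begin

definition embed :: "'b \<Rightarrow> 'b \<Rightarrow> 'a alg_closure" where
  "embed v = (\<lambda>b. to_ac (representation Basis v b))"

text \<open>
  The linear map with the given values on the basis vectors. It depends on the coordinates in
  the basis only, so it is defined on all functions, also those with other support.
\<close>

definition extend :: "('b \<Rightarrow> 'b \<Rightarrow> 'a alg_closure) \<Rightarrow> ('b \<Rightarrow> 'a alg_closure) \<Rightarrow> 'b \<Rightarrow> 'a alg_closure" where
  "extend h f = (\<Sum>b\<in>Basis. extended_scale (f b) (h b))"

abbreviation embedded_span :: "'b set \<Rightarrow> ('b \<Rightarrow> 'a alg_closure) set" where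
  "embedded_span D \<equiv> ext.span (embed ` D)"

lemma embed_add: "embed (x + y) = embed x + embed y"
  by (auto simp: embed_def plus_fun_apply representation_add independent_Basis span_Basis fun_eq_iff)

lemma embed_scale: "embed (scale c x) = extended_scale (to_ac c) (embed x)"
  by (auto simp: embed_def extended_scale_def representation_scale independent_Basis span_Basis fun_eq_iff)

lemma embed_eq_0_iff: "embed x = 0 \<longleftrightarrow> x = 0"
proof
  assume "embed x = 0"
  then have "representation Basis x b = 0" for b by (auto simp: embed_def fun_eq_iff zero_fun_apply)
  then show "x = 0"
    using sum_representation_eq[OF independent_Basis _ finite_Basis, of x] by (simp add: span_Basis)
next
  assume "x = 0"
  then show "embed x = 0" by (simp add: embed_def representation_zero fun_eq_iff zero_fun_apply)
qed

lemma embed_0: "embed 0 = 0"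
  by (simp only: embed_eq_0_iff)

lemma extend_add: "extend h (f + g) = extend h f + extend h g"
  by (simp add: extend_def plus_fun_apply ext.scale_left_distrib sum.distrib)

lemma extend_scale: "extend h (extended_scale c f) = extended_scale c (extend h f)"
  by (simp add: extend_def ext.scale_sum_right extended_scale_def[of c f])

lemma extend_0: "extend h 0 = 0"
  using extend_scale[of h 0 0] by (simp only: ext.scale_zero_left)

lemma linear_extend: "Vector_Spaces.linear extended_scale extended_scale (extend h)"
  by (simp add: Vector_Spaces.linear_iff ext.vector_space_axioms extend_add extend_scale)

text \<open>
  \<open>extend h\<close> agrees with \<open>h\<close> on embedded vectors as soon as \<open>h\<close> is linear over the smaller field.
\<close>

lemma extend_embed:
  assumes add: "\<And>x y. h (x + y) = h x + h y"
    and sc: "\<And>c x. h (scale c x) = extended_scale (to_ac c) (h x)"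
  shows "extend h (embed v) = h v"
proof -
  interpret additive h by unfold_locales (rule add)
  have "h v = h (\<Sum>b\<in>Basis. scale (representation Basis v b) b)"
    using sum_representation_eq[OF independent_Basis _ finite_Basis, of v] by (simp add: span_Basis)
  also have "\<dots> = extend h (embed v)" by (simp add: sum sc extend_def embed_def)
  finally show ?thesis by simp
qed

lemma extend_linear_embed:
  assumes "Vector_Spaces.linear scale scale A"
  shows "extend (\<lambda>b. embed (A b)) (embed v) = embed (A v)"
  using assms by (intro extend_embed) (simp_all add: Vector_Spaces.linear_iff embed_add embed_scale)

text \<open>
  Injectivity survives the extension of scalars, since a left inverse does.
\<close>

lemma extend_linear_injective:
  assumes h: "Vector_Spaces.linear scale scale h" "\<And>x. h x = 0 \<Longrightarrow> x = 0"
    and x: "x \<in> embedded_span D" "extend (\<lambda>b. embed (h b)) x = 0"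
  shows "x = 0"
proof -
  interpret h: Vector_Spaces.linear scale scale h by (rule h(1))
  interpret vector_space_pair scale scale by unfold_locales
  have "inj h" using h(2) by (simp add: h.inj_iff_eq_0)
  then obtain g where g: "Vector_Spaces.linear scale scale g" "g \<circ> h = id"
    using linear_injective_left_inverse[OF h(1)] by blast
  have gh: "g (h v) = v" for v using g(2) by (simp add: fun_eq_iff)
  have "extend (\<lambda>b. embed (g b)) (extend (\<lambda>b. embed (h b)) x) = x"
    using x(1)
  proof (induction rule: ext.span_induct_alt)
    case base
    show ?case by (simp only: extend_0)
  next
    case (step c y z)
    then obtain v where "y = embed v" by blast
    then show ?case
      using step.IH by (simp add: extend_add extend_scale extend_linear_embed[OF h(1)] extend_linear_embed[OF g(1)] gh)
  qed
  then show ?thesis using x(2) by (simp only: extend_0)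
qed

lemma apply_poly_embed:
  assumes A: "Vector_Spaces.linear scale scale A"
  shows "linear_operator.apply_poly extended_scale (extend (\<lambda>b. embed (A b))) (map_poly to_ac p) (embed v)
    = embed (linear_operator.apply_poly scale A p v)"
proof -
  interpret op: linear_operator scale A
    by (intro linear_operator.intro linear_operator_axioms.intro vector_space_axioms A)
  interpret opL: linear_operator extended_scale "extend (\<lambda>b. embed (A b))"
    by (intro linear_operator.intro linear_operator_axioms.intro ext.vector_space_axioms linear_extend)
  show ?thesis
  proof (induction p)
    case 0
    show ?case by (simp add: embed_0 op.apply_poly_0 opL.apply_poly_0)
  next
    case (pCons a p)
    then show ?case
      by (simp add: map_poly_pCons op.apply_poly_pCons opL.apply_poly_pCons embed_add embed_scale extend_linear_embed[OF A])
  qed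
qed

definition extended_bracket ::
  "('b \<Rightarrow> 'b \<Rightarrow> 'b) \<Rightarrow> ('b \<Rightarrow> 'a alg_closure) \<Rightarrow> ('b \<Rightarrow> 'a alg_closure) \<Rightarrow> 'b \<Rightarrow> 'a alg_closure" where
  "extended_bracket br f g = extend (\<lambda>b. extend (\<lambda>c. embed (br b c)) g) f"

lemma extended_bracket_eq:
  "extended_bracket br f g = (\<Sum>b\<in>Basis. \<Sum>c\<in>Basis. extended_scale (f b * g c) (embed (br b c)))"
  by (simp add: extended_bracket_def extend_def ext.scale_sum_right)

context
  fixes br
  assumes lie: "lie_algebra scale br"
begin

interpretation L: lie_algebra scale br by (rule lie)

lemma linear_extended_bracket:
  "Vector_Spaces.linear extended_scale extended_scale (\<lambda>f. extended_bracket br f g)"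
  "Vector_Spaces.linear extended_scale extended_scale (extended_bracket br f)"
proof -
  show "Vector_Spaces.linear extended_scale extended_scale (\<lambda>f. extended_bracket br f g)"
    unfolding extended_bracket_def by (rule linear_extend)
  show "Vector_Spaces.linear extended_scale extended_scale (extended_bracket br f)"
    unfolding Vector_Spaces.linear_iff
  proof (intro conjI allI ext.vector_space_axioms)
    show "extended_bracket br f (x + y) = extended_bracket br f x + extended_bracket br f y" for x y
      by (simp add: extended_bracket_eq plus_fun_apply distrib_left ext.scale_left_distrib sum.distrib)
    show "extended_bracket br f (extended_scale c x) = extended_scale c (extended_bracket br f x)" for c x
      by (simp add: extended_bracket_eq ext.scale_sum_right extended_scale_def[of c x] mult_ac)
  qed
qed

lemma extended_bracket_embed_right:
  "extended_bracket br f (embed v) = (\<Sum>b\<in>Basis. extended_scale (f b) (embed (br b v)))"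
proof -
  have "extend (\<lambda>c. embed (br b c)) (embed v) = embed (br b v)" for b
    by (rule extend_embed) (simp_all add: L.bracket_simps embed_add embed_scale)
  then show ?thesis by (simp add: extended_bracket_def extend_def[of "\<lambda>b. embed (br b v)"])
qed

lemma extended_bracket_embed: "extended_bracket br (embed u) (embed v) = embed (br u v)"
proof -
  have "extended_bracket br (embed u) (embed v) = extend (\<lambda>b. embed (br b v)) (embed u)"
    by (simp add: extended_bracket_embed_right extend_def)
  also have "\<dots> = embed (br u v)"
    by (rule extend_embed) (simp_all add: L.bracket_simps embed_add embed_scale)
  finally show ?thesis .
qed

lemma extended_bracket_bracket:
  "extended_bracket br f (extended_bracket br g h) =
    (\<Sum>b\<in>Basis. \<Sum>c\<in>Basis. \<Sum>d\<in>Basis. extended_scale (f b * g c * h d) (embed (br b (br c d))))"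
proof -
  interpret r: Vector_Spaces.linear extended_scale extended_scale "extended_bracket br f"
    by (rule linear_extended_bracket)
  have "extended_bracket br f (extended_bracket br g h) =
    (\<Sum>c\<in>Basis. \<Sum>d\<in>Basis. \<Sum>b\<in>Basis. extended_scale (f b * g c * h d) (embed (br b (br c d))))"
    by (simp add: extended_bracket_eq[of br g h] r.sum r.scale extended_bracket_embed_right ext.scale_sum_right mult_ac)
  also have "\<dots> = (\<Sum>c\<in>Basis. \<Sum>b\<in>Basis. \<Sum>d\<in>Basis. extended_scale (f b * g c * h d) (embed (br b (br c d))))"
    by (intro sum.cong refl sum.swap)
  also have "\<dots> = (\<Sum>b\<in>Basis. \<Sum>c\<in>Basis. \<Sum>d\<in>Basis. extended_scale (f b * g c * h d) (embed (br b (br c d))))"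
    by (rule sum.swap)
  finally show ?thesis .
qed

end

end

text \<open>
  The extended bracket is bilinear, so antisymmetry and the Jacobi identity of the basis vectors
  carry over once the sums are reordered to have the same coefficients.
\<close>

lemma lie_algebra_extended:
  fixes scale :: "'k::field_char_0 \<Rightarrow> 'v::ab_group_add \<Rightarrow> 'v"
  assumes fd: "finite_dimensional_vector_space scale Basis" and lie: "lie_algebra scale br"
  shows "lie_algebra extended_scale
    (finite_dimensional_vector_space.extended_bracket scale Basis br)"
proof -
  interpret finite_dimensional_vector_space scale Basis by (rule fd)
  interpret L: lie_algebra scale br by (rule lie)
  let ?b = "extended_bracket br"
  have embed_neg: "embed (- x) = - embed x" for x
    using embed_add[of x "- x"] embed_0 by (simp add: eq_neg_iff_add_eq_0 add.commute)
  show ?thesis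
  proof (intro lie_algebra.intro lie_algebra_axioms.intro ext.vector_space_axioms
      linear_extended_bracket[OF lie])
    fix f
    have "?b f f = (\<Sum>b\<in>Basis. \<Sum>c\<in>Basis. extended_scale (f c * f b) (embed (br c b)))"
      unfolding extended_bracket_eq by (rule sum.swap)
    also have "\<dots> = (\<Sum>b\<in>Basis. \<Sum>c\<in>Basis. - extended_scale (f b * f c) (embed (br b c)))"
    proof (intro sum.cong refl)
      fix b c
      show "extended_scale (f c * f b) (embed (br c b)) = - extended_scale (f b * f c) (embed (br b c))"
        unfolding L.bracket_anticomm[of c b] embed_neg by (simp add: mult.commute)
    qed
    also have "\<dots> = - ?b f f" by (simp add: extended_bracket_eq sum_negf)
    finally have "?b f f = - ?b f f" .
    then have "?b f f x = - ?b f f x" for x by (metis fun_Compl_def)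
    \<comment> \<open>The double sum equals its own negative, so it vanishes in characteristic zero.\<close>
    then have "2 * ?b f f x = 0" for x by (simp only: mult_2 eq_neg_iff_add_eq_0)
    then have "?b f f x = 0" for x by simp
    then show "?b f f = 0" by (simp add: fun_eq_iff zero_fun_apply)
  next
    fix f g h
    let ?S = "\<lambda>e. (\<Sum>b\<in>Basis. \<Sum>c\<in>Basis. \<Sum>d\<in>Basis. extended_scale (f b * g c * h d) (embed (e b c d)))"
    have 1: "?b f (?b g h) = ?S (\<lambda>b c d. br b (br c d))"
      by (rule extended_bracket_bracket[OF lie])
    have "?b g (?b h f) = (\<Sum>c\<in>Basis. \<Sum>d\<in>Basis. \<Sum>b\<in>Basis. extended_scale (f b * g c * h d) (embed (br c (br d b))))"
      unfolding extended_bracket_bracket[OF lie] by (simp add: mult_ac)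
    also have "\<dots> = (\<Sum>c\<in>Basis. \<Sum>b\<in>Basis. \<Sum>d\<in>Basis. extended_scale (f b * g c * h d) (embed (br c (br d b))))"
      by (intro sum.cong refl sum.swap)
    also have "\<dots> = ?S (\<lambda>b c d. br c (br d b))" by (rule sum.swap)
    finally have 2: "?b g (?b h f) = ?S (\<lambda>b c d. br c (br d b))" .
    have "?b h (?b f g) = (\<Sum>d\<in>Basis. \<Sum>b\<in>Basis. \<Sum>c\<in>Basis. extended_scale (f b * g c * h d) (embed (br d (br b c))))"
      unfolding extended_bracket_bracket[OF lie] by (simp add: mult_ac)
    also have "\<dots> = (\<Sum>b\<in>Basis. \<Sum>d\<in>Basis. \<Sum>c\<in>Basis. extended_scale (f b * g c * h d) (embed (br d (br b c))))"
      by (rule sum.swap)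
    also have "\<dots> = ?S (\<lambda>b c d. br d (br b c))" by (intro sum.cong refl sum.swap)
    finally have 3: "?b h (?b f g) = ?S (\<lambda>b c d. br d (br b c))" .
    have "embed (br b (br c d)) + embed (br c (br d b)) + embed (br d (br b c)) = 0" for b c d
      by (simp add: L.jacobi embed_0 flip: embed_add)
    then show "?b f (?b g h) + ?b g (?b h f) + ?b h (?b f g) = 0"
      unfolding 1 2 3 by (simp flip: sum.distrib ext.scale_right_distrib)
  qed
qed

section \<open>Automorphisms without fixed points\<close>

lemma (in lie_algebra) subspace_derived_series: "subspace (derived_series scale bracket n)"
  by (cases n) auto

lemma (in lie_algebra) derived_series_decreasing:
  "derived_series scale bracket (Suc n) \<subseteq> derived_series scale bracket n"
proof (induction n)
  case (Suc n)
  then show ?case by (simp only: derived_series.simps(2)[of scale bracket]) (rule span_mono, blast)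
qed simp

lemma (in lie_algebra) derived_series_image:
  assumes A: "Vector_Spaces.linear scale scale A" and hom: "\<And>x y. A (bracket x y) = bracket (A x) (A y)"
  shows "x \<in> derived_series scale bracket n \<Longrightarrow> A x \<in> derived_series scale bracket n"
proof (induction n arbitrary: x)
  case (Suc n)
  interpret A: Vector_Spaces.linear scale scale A by (rule A)
  let ?D = "derived_series scale bracket n"
  let ?B = "{bracket x y | x y. x \<in> ?D \<and> y \<in> ?D}"
  have "A ` ?B \<subseteq> ?B" using Suc.IH by (auto simp: hom) blast
  then have "A ` span ?B \<subseteq> span ?B" unfolding A.span_image[symmetric] by (rule span_mono)
  then show ?case using Suc.prems by auto
qed simp

lemma derived_series_stabilizes:
  assumes fd: "finite_dimensional_vector_space scale Basis" and lie: "lie_algebra scale br"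
  shows "\<exists>n. derived_series scale br (Suc n) = derived_series scale br n"
proof -
  interpret finite_dimensional_vector_space scale Basis by (rule fd)
  interpret lie_algebra scale br by (rule lie)
  let ?d = "\<lambda>n. dim (derived_series scale br n)"
  have "\<exists>n. ?d n \<le> ?d (Suc n)"
  proof (rule ccontr)
    assume "\<nexists>n. ?d n \<le> ?d (Suc n)"
    then have dec: "?d (Suc n) < ?d n" for n by (simp add: not_le)
    have "?d n + n \<le> ?d 0" for n
    proof (induction n)
      case (Suc n)
      then show ?case using dec[of n] by linarith
    qed simp
    from this[of "Suc (?d 0)"] show False by linarith
  qed
  then obtain n where "?d n \<le> ?d (Suc n)" by blast
  then show ?thesis
    using subspace_dim_equal[OF subspace_derived_series subspace_derived_series derived_series_decreasing] by blast
qed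

text \<open>
  The derived series becomes stationary at a perfect subalgebra \<open>D\<close> that is invariant under \<open>A\<close>.
  After extension of scalars, \<open>perfect_fixed_point_free_trivial\<close> applies to the span of \<open>D\<close>, so \<open>D\<close>
  is trivial. No fixed vector appears in the extension, because the injective operator \<open>A - id\<close> has a
  left inverse.
\<close>

theorem fixed_point_free_automorphism_imp_solvable:
  fixes scale :: "'k::field_char_0 \<Rightarrow> 'v::ab_group_add \<Rightarrow> 'v"
  assumes fd: "finite_dimensional_vector_space scale Basis" and lie: "lie_algebra scale br"
    and A: "Vector_Spaces.linear scale scale A" and hom: "\<And>x y. A (br x y) = br (A x) (A y)"
    and inj: "\<And>x. A x = 0 \<Longrightarrow> x = 0" and fixed: "\<And>x. A x = x \<Longrightarrow> x = 0"
  shows "lie_solvable scale br"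
proof -
  interpret finite_dimensional_vector_space scale Basis by (rule fd)
  interpret L: lie_algebra scale br by (rule lie)
  obtain n where n: "derived_series scale br (Suc n) = derived_series scale br n"
    using derived_series_stabilizes[OF fd lie] by blast
  define D where "D = derived_series scale br n"
  have D: "D = span {br x y | x y. x \<in> D \<and> y \<in> D}" using n unfolding D_def by simp
  have subD: "subspace D" unfolding D_def by (rule L.subspace_derived_series)
  have AD: "A x \<in> D" if "x \<in> D" for x
    using L.derived_series_image[OF A hom] that unfolding D_def by blast
  let ?A = "extend (\<lambda>b. embed (A b))" and ?br = "extended_bracket br"
  define N where "N = embedded_span D"
  interpret E: lie_algebra extended_scale ?br by (rule lie_algebra_extended[OF fd lie])
  interpret opL: linear_operator extended_scale ?A
    by (intro linear_operator.intro linear_operator_axioms.intro ext.vector_space_axioms linear_extend)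
  have DN: "embed x \<in> N" if "x \<in> D" for x unfolding N_def using that by (intro ext.span_base) blast
  obtain B where B: "B \<subseteq> D" "independent B" "D \<subseteq> span B"
    by (rule basis_exists[of D])
  have "N = ext.span (embed ` B)"
  proof
    show "ext.span (embed ` B) \<subseteq> N" unfolding N_def using B(1) by (intro ext.span_mono) blast
    have "embed v \<in> ext.span (embed ` B)" if "v \<in> span B" for v
      using that
    proof (induction rule: span_induct_alt)
      case base
      show ?case unfolding embed_0 by (rule ext.span_zero)
    next
      case (step c x y)
      then show ?case by (auto simp: embed_add embed_scale intro!: ext.span_add ext.span_scale intro: ext.span_base)
    qed
    then show "N \<subseteq> ext.span (embed ` B)" unfolding N_def using B(3) by (intro ext.span_minimal) auto
  qed
  moreover have "N = {0}"
  proof (rule perfect_fixed_point_free_trivial[of extended_scale ?br ?A N "embed ` B"])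
    show "lie_algebra extended_scale ?br" by (rule E.lie_algebra_axioms)
    show "linear_operator extended_scale ?A" by (rule opL.linear_operator_axioms)
    show "?A (?br f g) = ?br (?A f) (?A g)" for f g
    proof -
      interpret l: Vector_Spaces.linear extended_scale extended_scale "\<lambda>f. ?br f y" for y
        by (rule linear_extended_bracket[OF lie])
      interpret r: Vector_Spaces.linear extended_scale extended_scale "?br x" for x
        by (rule linear_extended_bracket[OF lie])
      have "?A (?br f g) = (\<Sum>b\<in>Basis. \<Sum>c\<in>Basis. extended_scale (f b * g c) (embed (br (A b) (A c))))"
        by (simp add: extended_bracket_eq[of br f g] opL.A_simps extend_linear_embed[OF A] hom)
      also have "\<dots> = ?br (?A f) (?A g)"
        unfolding extend_def
        by (simp add: l.sum l.scale r.sum r.scale extended_bracket_embed[OF lie] ext.scale_sum_right)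
          (subst sum.swap, simp add: mult.commute)
      finally show ?thesis .
    qed
    show "?A x \<in> N" if "x \<in> N" for x
      using that unfolding N_def
    proof (induction rule: ext.span_induct_alt)
      case base
      show ?case unfolding opL.A_simps(1) by (rule ext.span_zero)
    next
      case (step c x y)
      then obtain v where "v \<in> D" "x = embed v" by blast
      then have "?A x \<in> embedded_span D" using AD DN unfolding N_def by (simp add: extend_linear_embed[OF A])
      then show ?case using step.IH by (simp add: opL.A_simps ext.span_add ext.span_scale)
    qed
    show "N = ext.span {?br x y | x y. x \<in> N \<and> y \<in> N}" (is "_ = ?P")
    proof
      have "embed v \<in> ?P" if "v \<in> span {br x y | x y. x \<in> D \<and> y \<in> D}" for v
        using that
      proof (induction rule: span_induct_alt)
        case base
        show ?case unfolding embed_0 by (rule ext.span_zero)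
      next
        case (step c x y)
        then obtain u w where uw: "x = br u w" "u \<in> D" "w \<in> D" by blast
        have "?br (embed u) (embed w) \<in> ?P" by (rule ext.span_base) (use uw DN in blast)
        then have "embed x \<in> ?P" using uw by (simp add: extended_bracket_embed[OF lie])
        then show ?case using step.IH by (simp add: embed_add embed_scale ext.span_add ext.span_scale)
      qed
      then show "N \<subseteq> ?P" unfolding N_def using D by (intro ext.span_minimal) auto
      have e: "?br x (embed v) \<in> N" if "x \<in> N" "v \<in> D" for x v
        using that(1) unfolding N_def
      proof (induction rule: ext.span_induct_alt)
        case base
        show ?case unfolding E.bracket_simps(1,2) by (rule ext.span_zero)
      next
        case (step c x y)
        then obtain u where u: "u \<in> D" "x = embed u" by blast
        have "br u v \<in> D" by (subst D, rule span_base) (use u that in blast)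
        then have "?br x (embed v) \<in> embedded_span D"
          using DN u unfolding N_def by (simp add: extended_bracket_embed[OF lie])
        then show ?case using step.IH by (simp add: E.bracket_simps ext.span_add ext.span_scale)
      qed
      have "?br x y \<in> N" if "x \<in> N" "y \<in> N" for x y
        using that(2) unfolding N_def
      proof (induction rule: ext.span_induct_alt)
        case base
        show ?case unfolding E.bracket_simps(1,2) by (rule ext.span_zero)
      next
        case (step c y z)
        then have "?br x y \<in> embedded_span D" using e[OF that(1)] unfolding N_def by blast
        then show ?case using step.IH by (simp add: E.bracket_simps ext.span_add ext.span_scale)
      qed
      then show "?P \<subseteq> N" unfolding N_def by (intro ext.span_minimal) auto
    qed
    show "finite (embed ` B)" using finiteI_independent[OF B(2)] by simp
    show "N = ext.span (embed ` B)" by fact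
    show "\<exists>p. p \<noteq> 0 \<and> opL.apply_poly p x = 0" if "x \<in> embed ` B" for x
    proof -
      from that obtain v where v: "x = embed v" by blast
      obtain p where p: "p \<noteq> 0" "linear_operator.apply_poly scale A p v = 0"
        using annihilating_poly_exists[OF A] by blast
      have "map_poly to_ac p \<noteq> 0" using p(1) by (simp add: map_poly_eq_0_iff)
      moreover have "opL.apply_poly (map_poly to_ac p) x = 0"
        unfolding v apply_poly_embed[OF A] p(2) by (simp add: embed_eq_0_iff)
      ultimately show ?thesis by blast
    qed
    show "x = 0" if "x \<in> N" "?A x = 0" for x
      using extend_linear_injective[OF A inj] that unfolding N_def by blast
    show "x = 0" if "x \<in> N" "?A x = x" for x
    proof (rule extend_linear_injective)
      let ?h = "\<lambda>x. A x - x"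
      interpret op: Vector_Spaces.linear scale scale A by (rule A)
      show h: "Vector_Spaces.linear scale scale ?h"
        by (simp add: Vector_Spaces.linear_iff vector_space_axioms op.add op.scale scale_right_diff_distrib)
      show "v = 0" if "?h v = 0" for v using that fixed by simp
      show "x \<in> embedded_span D" using that(1) by (simp add: N_def)
      have "extend (\<lambda>b. embed (?h b)) y = ?A y - y" if "y \<in> N" for y
        using that unfolding N_def
      proof (induction rule: ext.span_induct_alt)
        case base
        show ?case by (simp only: extend_0 diff_self)
      next
        case (step c y z)
        then obtain v where v: "y = embed v" by blast
        have "embed (?h v) + embed v = embed (A v)" by (simp flip: embed_add)
        then have "embed (?h v) = embed (A v) - embed v" by (simp add: eq_diff_eq)
        then show ?case using step.IH
          by (simp add: v extend_add extend_scale extend_linear_embed[OF A] extend_linear_embed[OF h]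
              ext.scale_right_diff_distrib add_diff_add del: minus_apply)
      qed
      then show "extend (\<lambda>b. embed (?h b)) x = 0" using that by simp
    qed
  qed
  ultimately have "D \<subseteq> {0}" using DN embed_eq_0_iff by auto
  then have "D = {0}" using subspace_0[OF subD] by blast
  then show ?thesis unfolding lie_solvable_def D_def by blast
qed

section \<open>Rota--Baxter operators of weight 1\<close>

lemma derived_series_surjective_image:
  assumes f: "Vector_Spaces.linear s1 s2 f" "surj f" and hom: "\<And>x y. f (br1 x y) = br2 (f x) (f y)"
  shows "derived_series s2 br2 n = f ` derived_series s1 br1 n"
proof (induction n)
  case 0
  then show ?case using f(2) by simp
next
  case (Suc n)
  interpret f: Vector_Spaces.linear s1 s2 f by (rule f(1))
  let ?D = "derived_series s1 br1 n"
  have "{br2 x y | x y. x \<in> f ` ?D \<and> y \<in> f ` ?D} = f ` {br1 x y | x y. x \<in> ?D \<and> y \<in> ?D}"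
  proof (intro equalityI subsetI)
    fix z assume "z \<in> {br2 x y | x y. x \<in> f ` ?D \<and> y \<in> f ` ?D}"
    then obtain a b where ab: "a \<in> ?D" "b \<in> ?D" "z = br2 (f a) (f b)" by blast
    then have "z = f (br1 a b)" by (simp only: hom)
    with ab(1,2) show "z \<in> f ` {br1 x y | x y. x \<in> ?D \<and> y \<in> ?D}" by blast
  next
    fix z assume "z \<in> f ` {br1 x y | x y. x \<in> ?D \<and> y \<in> ?D}"
    then obtain a b where ab: "a \<in> ?D" "b \<in> ?D" "z = f (br1 a b)" by blast
    then have "z = br2 (f a) (f b)" by (simp only: hom)
    with ab(1,2) show "z \<in> {br2 x y | x y. x \<in> f ` ?D \<and> y \<in> f ` ?D}" by blast
  qed
  then show ?case using Suc.IH by (simp add: f.span_image)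
qed

lemma lie_isomorphic_solvable:
  assumes "lie_isomorphic s1 br1 s2 br2"
  shows "lie_solvable s1 br1 \<longleftrightarrow> lie_solvable s2 br2"
proof -
  obtain f where f: "Vector_Spaces.linear s1 s2 f" "bij f" "\<And>x y. f (br1 x y) = br2 (f x) (f y)"
    using assms unfolding lie_isomorphic_def by blast
  interpret f: Vector_Spaces.linear s1 s2 f by (rule f(1))
  have inj: "inj f" and surj: "surj f" using f(2) by (auto simp: bij_def)
  have "derived_series s2 br2 n = {0} \<longleftrightarrow> derived_series s1 br1 n = {0}" for n
    unfolding derived_series_surjective_image[of s1 s2 f br1 br2, OF f(1) surj f(3)]
    using inj_image_eq_iff[OF inj, of "derived_series s1 br1 n" "{0}"] by (simp add: f.zero)
  then show ?thesis unfolding lie_solvable_def by simp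
qed

theorem proposition2p21:
  fixes scale :: "'k::field_char_0 \<Rightarrow> 'v::ab_group_add \<Rightarrow> 'v"
    and Basis :: "'v set"
    and nbr gbr dot :: "'v \<Rightarrow> 'v \<Rightarrow> 'v"
    and R :: "'v \<Rightarrow> 'v"
  assumes "finite_dimensional_vector_space scale Basis"
    and "lie_algebra scale nbr"
    and "rota_baxter scale nbr R"
    and "\<And>x y. gbr x y = nbr (R x) y - nbr (R y) x + nbr x y"
    and "\<And>x y. dot x y = nbr (R x) y"
  shows "(\<not> lie_isomorphic scale gbr scale nbr \<longrightarrow>
            kernel R \<noteq> {0} \<and> kernel (\<lambda>x. R x + x) \<noteq> {0})
       \<and> (\<not> lie_solvable scale gbr \<or> \<not> lie_solvable scale nbr \<longrightarrow>
            kernel R \<noteq> {0} \<or> kernel (\<lambda>x. R x + x) \<noteq> {0})"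
proof -
  interpret finite_dimensional_vector_space scale Basis by (rule assms(1))
  interpret rota_baxter scale nbr R by (rule assms(3))
  let ?Q = "\<lambda>x. R x + x"
  have linQ: "Vector_Spaces.linear scale scale ?Q"
    by (rule lin) (simp_all add: R_simps scale_right_distrib)
  have gbr: "gbr = induced_bracket" by (intro ext) (simp add: assms(4) induced_bracket_def)
  have homR: "R (gbr x y) = nbr (R x) (R y)" for x y unfolding gbr by (rule R_induced_bracket)
  \<comment> \<open>\<open>R + id\<close> is a homomorphism for the same reason as \<open>R\<close>: the missing terms of \<open>{R x + x, R y + y}\<close>
    are exactly the bracket of \<open>g\<close>.\<close>
  have homQ: "?Q (gbr x y) = nbr (?Q x) (?Q y)" for x y
    unfolding homR using nbr_anticomm[of x "R y"] by (simp add: assms(4) nbr_simps)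
  have bij: "bij f" if "Vector_Spaces.linear scale scale f" "kernel f = {0}" for f
  proof -
    interpret f: Vector_Spaces.linear scale scale f by (rule that(1))
    have "inj f" using that(2) unfolding f.inj_iff_eq_0 kernel_def by blast
    then show ?thesis using linear_inj_imp_surj[OF that(1)] by (simp add: bij_def)
  qed
  have isoR: "lie_isomorphic scale gbr scale nbr" if "kernel R = {0}"
    unfolding lie_isomorphic_def using bij[OF linear_R that] linear_R homR by blast
  have isoQ: "lie_isomorphic scale gbr scale nbr" if "kernel ?Q = {0}"
    unfolding lie_isomorphic_def using bij[OF linQ that] linQ homQ by blast
  have "lie_solvable scale gbr \<and> lie_solvable scale nbr" if ker: "kernel R = {0}" "kernel ?Q = {0}"
  proof -
    have bR: "bij R" by (rule bij[OF linear_R ker(1)])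
    define S where "S = inv_into UNIV R"
    have RS: "R (S x) = x" for x using bR by (simp add: S_def bij_is_surj surj_f_inv_f)
    have SR: "S (R x) = x" for x using bR by (simp add: S_def bij_is_inj)
    have SI: "S u = v" if "R v = u" for u v using SR that by blast
    \<comment> \<open>This is \<open>R + id\<close> composed with the inverse of \<open>R\<close>, so it is an automorphism of \<open>n\<close>; it fixes \<open>x\<close>
      only if \<open>S x = 0\<close>.\<close>
    let ?A = "\<lambda>x. x + S x"
    have QS: "?A x = ?Q (S x)" for x by (simp add: RS)
    have linA: "Vector_Spaces.linear scale scale ?A"
    proof (rule lin)
      have "S (x + y) = S x + S y" for x y by (rule SI) (simp add: R_simps RS)
      then show "?A (x + y) = ?A x + ?A y" for x y by (simp add: algebra_simps)
      have "S (scale c x) = scale c (S x)" for c x by (rule SI) (simp add: R_simps RS)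
      then show "?A (scale c x) = scale c (?A x)" for c x by (simp add: scale_right_distrib)
    qed
    have "S (nbr x y) = gbr (S x) (S y)" for x y by (rule SI) (simp add: homR RS)
    then have homA: "?A (nbr x y) = nbr (?A x) (?A y)" for x y
      unfolding QS homQ[symmetric] by simp
    have S0: "x = 0" if "S x = 0" for x using RS[of x] that R_simps(1)[of 0 0] by simp
    have "lie_solvable scale nbr"
    proof (rule fixed_point_free_automorphism_imp_solvable[of scale Basis nbr ?A, OF assms(1,2) linA homA])
      show "x = 0" if "?A x = 0" for x
      proof -
        have "S x \<in> kernel ?Q" using that by (simp add: kernel_def RS)
        then show ?thesis using ker(2) S0 by simp
      qed
      show "x = 0" if "?A x = x" for x using that S0 by simp
    qed
    then show ?thesis using lie_isomorphic_solvable[OF isoR[OF ker(1)]] by blast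
  qed
  then show ?thesis using isoR isoQ by blast
qed

end
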